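(* Let $G$ be a special Gromov monster group, let $f:X\to G$ be a coarse embedding of a large girth, expander box space $X$ into $G$, and let $Z=f(X)$. Let $\beta G$ be the Stone-Čech compactification of $G$, $\partial G=\beta G\setminus G$, and $$Y=\Big(\bigcup_{R\in\mathbb{N}}\overline{N_R(Z)}\Big)\cap\partial G,$$ where $N_R(Z)$ is the $R$-neighbourhood of $Z$ in $G$ and closures are taken in $\beta G$. Then the action of $G$ on $Y$ induced by right multiplication of $G$ on itself is a-T-menable.
   Context: Graphs are identified with their vertex sets, with the edge metric. Let $(X_n)$ be a sequence of non-empty finite connected graphs with a uniform bound on all vertex degrees. The box space $X=\sqcup_nX_n$ carries a metric restricting to the edge metric on each $X_n$ with $d(X_n,\sqcup_{m\ne n}X_m)\to\infty$ as $n\to\infty$. It has large girth if the girth of $X_n$ (length of the shortest non-trivial cycle, or $\infty$) tends to infinity. It is an expander if there is $c>1$ such that for all $n$ and all non-empty $F\subseteq X_n$ with $|F|\le|X_n|/2$, $|\{x\in X_n:d(x,F)\le1\}|\ge c|F|$. A map $f:X\to Y$ of metric spaces is a coarse embedding if there are non-decreasing $\rho_\pm:\mathbb{R}_+\to\mathbb{R}_+$ with $\rho_-(d(x_1,x_2))\le d(f(x_1),f(x_2))\le\rho_+(d(x_1,x_2))$ for all $x_1,x_2$ and $\rho_-(t)\to\infty$ as $t\to\infty$. A finitely generated discrete group $G$, with a word length $\ell$ and left-invariant metric $d(x,y)=\ell(x^{-1}y)$, is a special Gromov monster if some large girth expander box space coarsely embeds in $G$. Since $d(x,xg)=\ell(g)$,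 right multiplication preserves $A=\overline{\bigcup_R\ell^\infty(N_R(Z))}\subseteq\ell^\infty(G)$ and its ideal $C_0(G)$, and $Y$ is the spectrum of the $G$-$C^*$-algebra $A/C_0(G)$; this gives the (right) action of $G$ on the locally compact Hausdorff space $Y$. Let a locally compact group $G$ act on the right on a locally compact Hausdorff space $Y$. A function $h:Y\times G\to\mathbb{R}$ is of conditionally negative type if (i) $h(y,e)=0$ for all $y$; (ii) $h(y,g)=h(yg,g^{-1})$ for all $y,g$; (iii) for every $y\in Y$ and all finite families $g_1,\dots,g_n\in G$, $t_1,\dots,t_n\in\mathbb{R}$ with $\sum_it_i=0$, $\sum_{i,j=1}^nt_it_jh(yg_i,g_i^{-1}g_j)\le0$. The action is a-T-menable if there is a continuous function $h$ of conditionally negative type that is locally proper: for every compact $K\subseteq Y$ the restriction of $h$ to $\{(y,g)\in Y\times G:y\in K,\ yg\in K\}$ is a proper function. *)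

theory Defs
  imports "HOL-Analysis.Analysis" "HOL-Algebra.Generated_Groups"
begin

no_notation eq_closure_of (\<open>closure'_of\<index>\<close>)

section \<open>Graphs\<close>

text \<open>A simple graph is a vertex set \<open>V\<close> with a symmetric irreflexive edge relation
  \<open>E \<subseteq> V \<times> V\<close>, each undirected edge being recorded in both directions.\<close>

definition finite_connected_graph :: "'v set \<Rightarrow> ('v \<times> 'v) set \<Rightarrow> bool" where
  "finite_connected_graph V E \<longleftrightarrow>
     finite V \<and> V \<noteq> {} \<and> E \<subseteq> V \<times> V \<and> sym E \<and> irrefl E \<and> (\<forall>u\<in>V. \<forall>v\<in>V. (u, v) \<in> E\<^sup>*)"

definition vertex_degree :: "('v \<times> 'v) set \<Rightarrow> 'v \<Rightarrow> nat" where
  "vertex_degree E v = card {u. (v, u) \<in> E}"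

definition edge_dist :: "('v \<times> 'v) set \<Rightarrow> 'v \<Rightarrow> 'v \<Rightarrow> nat" where
  "edge_dist E u v = (LEAST k. (u, v) \<in> E ^^ k)"

text \<open>A cycle is the list of its (pairwise distinct) vertices in cyclic order; its length is the
  length of the list. The bound \<open>3\<close> excludes going back and forth along one edge.\<close>

definition is_cycle :: "('v \<times> 'v) set \<Rightarrow> 'v list \<Rightarrow> bool" where
  "is_cycle E c \<longleftrightarrow>
     3 \<le> length c \<and> distinct c \<and> successively (\<lambda>u v. (u, v) \<in> E) c \<and> (last c, hd c) \<in> E"

definition girth :: "('v \<times> 'v) set \<Rightarrow> enat" where
  "girth E = (INF c \<in> {c. is_cycle E c}. enat (length c))"


section \<open>Box spaces\<close>

text \<open>The disjoint union of the \<open>V n\<close> consists of pairs \<open>(n, v)\<close> with \<open>v \<in> V n\<close>.\<close>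

definition box_points :: "(nat \<Rightarrow> 'v set) \<Rightarrow> (nat \<times> 'v) set" where
  "box_points V = Sigma UNIV V"

definition box_component :: "(nat \<Rightarrow> 'v set) \<Rightarrow> nat \<Rightarrow> (nat \<times> 'v) set" where
  "box_component V n = {n} \<times> V n"

definition set_dist :: "('x \<Rightarrow> 'x \<Rightarrow> real) \<Rightarrow> 'x set \<Rightarrow> 'x set \<Rightarrow> real" where
  "set_dist d A B = (INF (x, y) \<in> A \<times> B. d x y)"

definition box_space ::
  "(nat \<Rightarrow> 'v set) \<Rightarrow> (nat \<Rightarrow> ('v \<times> 'v) set) \<Rightarrow> (nat \<times> 'v \<Rightarrow> nat \<times> 'v \<Rightarrow> real) \<Rightarrow> bool" where
  "box_space V E d \<longleftrightarrow>
     (\<forall>n. finite_connected_graph (V n) (E n)) \<and>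
     (\<exists>D. \<forall>n. \<forall>v\<in>V n. vertex_degree (E n) v \<le> D) \<and>
     Metric_space (box_points V) d \<and>
     (\<forall>n. \<forall>u\<in>V n. \<forall>v\<in>V n. d (n, u) (n, v) = real (edge_dist (E n) u v)) \<and>
     filterlim (\<lambda>n. set_dist d (box_component V n) (\<Union>m\<in>-{n}. box_component V m)) at_top sequentially"

definition large_girth :: "(nat \<Rightarrow> ('v \<times> 'v) set) \<Rightarrow> bool" where
  "large_girth E \<longleftrightarrow> (\<lambda>n. girth (E n)) \<longlonglongrightarrow> \<infinity>"

definition expander :: "(nat \<Rightarrow> 'v set) \<Rightarrow> (nat \<Rightarrow> ('v \<times> 'v) set) \<Rightarrow> bool" where
  "expander V E \<longleftrightarrow>
     (\<exists>c::real. c > 1 \<and>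
        (\<forall>n. \<forall>F \<subseteq> V n. F \<noteq> {} \<and> real (card F) \<le> real (card (V n)) / 2 \<longrightarrow>
           real (card {x \<in> V n. (INF y\<in>F. edge_dist (E n) x y) \<le> 1}) \<ge> c * real (card F)))"

definition coarse_embedding ::
  "'x set \<Rightarrow> ('x \<Rightarrow> 'x \<Rightarrow> real) \<Rightarrow> 'y set \<Rightarrow> ('y \<Rightarrow> 'y \<Rightarrow> real) \<Rightarrow> ('x \<Rightarrow> 'y) \<Rightarrow> bool" where
  "coarse_embedding M1 d1 M2 d2 f \<longleftrightarrow>
     f \<in> M1 \<rightarrow> M2 \<and>
     (\<exists>rho_minus rho_plus :: real \<Rightarrow> real.
        rho_minus \<in> {0..} \<rightarrow> {0..} \<and> rho_plus \<in> {0..} \<rightarrow> {0..} \<and>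
        mono_on {0..} rho_minus \<and> mono_on {0..} rho_plus \<and>
        (\<forall>x1\<in>M1. \<forall>x2\<in>M1. rho_minus (d1 x1 x2) \<le> d2 (f x1) (f x2) \<and>
                           d2 (f x1) (f x2) \<le> rho_plus (d1 x1 x2)) \<and>
        filterlim rho_minus at_top at_top)"


section \<open>Finitely generated groups\<close>

definition finite_generating_set :: "('g, 'm) monoid_scheme \<Rightarrow> 'g set \<Rightarrow> bool" where
  "finite_generating_set G S \<longleftrightarrow> finite S \<and> S \<subseteq> carrier G \<and> generate G S = carrier G"

definition word_length :: "('g, 'm) monoid_scheme \<Rightarrow> 'g set \<Rightarrow> 'g \<Rightarrow> nat" where
  "word_length G S g =
     (LEAST n. \<exists>ws. length ws = n \<and> set ws \<subseteq> S \<union> m_inv G ` S \<and> foldr (\<otimes>\<^bsub>G\<^esub>) ws \<one>\<^bsub>G\<^esub> = g)"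

definition word_dist :: "('g, 'm) monoid_scheme \<Rightarrow> 'g set \<Rightarrow> 'g \<Rightarrow> 'g \<Rightarrow> real" where
  "word_dist G S x y = real (word_length G S (inv\<^bsub>G\<^esub> x \<otimes>\<^bsub>G\<^esub> y))"

definition nbhd :: "('g, 'm) monoid_scheme \<Rightarrow> 'g set \<Rightarrow> real \<Rightarrow> 'g set \<Rightarrow> 'g set" where
  "nbhd G S R Z = {g \<in> carrier G. \<exists>z\<in>Z. word_dist G S g z \<le> R}"

text \<open>The vertices of the witnessing graphs may be taken to be natural numbers, since every finite
  graph is isomorphic to such a graph.\<close>

definition special_gromov_monster :: "('g, 'm) monoid_scheme \<Rightarrow> 'g set \<Rightarrow> bool" where
  "special_gromov_monster G S \<longleftrightarrow>
     group G \<and> finite_generating_set G S \<and>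
     (\<exists>(V :: nat \<Rightarrow> nat set) E d f.
        box_space V E d \<and> large_girth E \<and> expander V E \<and>
        coarse_embedding (box_points V) d (carrier G) (word_dist G S) f)"


section \<open>The Stone-Cech compactification\<close>

text \<open>The closure of the image of \<open>X\<close> in the cube \<open>[0,1]\<^sup>C\<close>, where \<open>C\<close> is the set of continuous
  functions \<open>X \<rightarrow> [0,1]\<close>. These are taken to be extensional, so that they are determined by
  their values on \<open>topspace X\<close>.\<close>

definition unit_functions :: "'a topology \<Rightarrow> ('a \<Rightarrow> real) set" where
  "unit_functions X = {\<phi> \<in> extensional (topspace X). continuous_map X (top_of_set {0..1}) \<phi>}"

definition stone_cech_embed :: "'a topology \<Rightarrow> 'a \<Rightarrow> (('a \<Rightarrow> real) \<Rightarrow> real)" where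
  "stone_cech_embed X x = (\<lambda>\<phi>\<in>unit_functions X. \<phi> x)"

definition stone_cech_cube :: "'a topology \<Rightarrow> (('a \<Rightarrow> real) \<Rightarrow> real) topology" where
  "stone_cech_cube X = product_topology (\<lambda>_. top_of_set {0..1}) (unit_functions X)"

definition stone_cech :: "'a topology \<Rightarrow> (('a \<Rightarrow> real) \<Rightarrow> real) topology" where
  "stone_cech X = subtopology (stone_cech_cube X)
     (stone_cech_cube X closure_of (stone_cech_embed X ` topspace X))"

text \<open>The continuous extension of a continuous map \<open>f : X \<rightarrow> Y\<close> to the compactifications,
  \<open>x \<mapsto> (\<phi> \<mapsto> x (\<phi> \<circ> f))\<close>.\<close>

definition stone_cech_map ::
  "'a topology \<Rightarrow> 'b topology \<Rightarrow> ('a \<Rightarrow> 'b) \<Rightarrow> (('a \<Rightarrow> real) \<Rightarrow> real) \<Rightarrow> (('b \<Rightarrow> real) \<Rightarrow> real)" where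
  "stone_cech_map X Y f x = (\<lambda>\<phi>\<in>unit_functions Y. x (compose (topspace X) \<phi> f))"

lemma topspace_stone_cech_cube:
  "topspace (stone_cech_cube X) = unit_functions X \<rightarrow>\<^sub>E {0..1}"
  by (simp add: stone_cech_cube_def)

lemma unit_functions_bounds:
  "\<phi> \<in> unit_functions X \<Longrightarrow> x \<in> topspace X \<Longrightarrow> 0 \<le> \<phi> x \<and> \<phi> x \<le> 1"
  by (auto simp: unit_functions_def continuous_map_in_subtopology)

lemma stone_cech_embed_in_cube:
  "x \<in> topspace X \<Longrightarrow> stone_cech_embed X x \<in> topspace (stone_cech_cube X)"
  by (simp add: topspace_stone_cech_cube stone_cech_embed_def unit_functions_bounds)

lemma continuous_map_stone_cech_embed_cube:
  "continuous_map X (stone_cech_cube X) (stone_cech_embed X)"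
proof -
  have "continuous_map X (top_of_set {0..1}) (\<lambda>x. stone_cech_embed X x \<phi>)"
    if "\<phi> \<in> unit_functions X" for \<phi>
    using that by (simp add: stone_cech_embed_def unit_functions_def eta_contract_eq)
  then show ?thesis
    unfolding stone_cech_cube_def continuous_map_componentwise
    by (auto simp: stone_cech_embed_def)
qed

lemma topspace_stone_cech:
  "topspace (stone_cech X) = stone_cech_cube X closure_of (stone_cech_embed X ` topspace X)"
  by (simp add: stone_cech_def closure_of_subset_topspace inf.absorb2)

lemma stone_cech_embed_image_subset:
  "stone_cech_embed X ` topspace X \<subseteq> stone_cech_cube X closure_of (stone_cech_embed X ` topspace X)"
  by (intro closure_of_subset image_subsetI stone_cech_embed_in_cube)

lemma continuous_map_stone_cech_embed:
  "continuous_map X (stone_cech X) (stone_cech_embed X)"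
  unfolding stone_cech_def continuous_map_in_subtopology
  by (simp add: continuous_map_stone_cech_embed_cube stone_cech_embed_image_subset
      flip: image_subset_iff_funcset)

lemma compact_space_stone_cech: "compact_space (stone_cech X)"
proof -
  have "compact_space (stone_cech_cube X)"
    unfolding stone_cech_cube_def
    by (simp add: compact_space_product_topology compact_space_subtopology)
  then show ?thesis
    unfolding stone_cech_def
    by (meson closedin_closure_of closedin_compact_space compact_space_subtopology)
qed

lemma Hausdorff_space_stone_cech: "Hausdorff_space (stone_cech X)"
  unfolding stone_cech_def stone_cech_cube_def
  by (meson Hausdorff_space_euclidean Hausdorff_space_product_topology Hausdorff_space_subtopology)

lemma dense_stone_cech_embed:
  "stone_cech X closure_of (stone_cech_embed X ` topspace X) = topspace (stone_cech X)"
proof -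
  have "stone_cech X closure_of (stone_cech_embed X ` topspace X) =
        topspace (stone_cech X) \<inter> (stone_cech_cube X closure_of (stone_cech_embed X ` topspace X))"
    by (simp add: stone_cech_def closure_of_subtopology stone_cech_embed_image_subset inf.absorb2
        closure_of_subset_topspace)
  then show ?thesis
    by (simp add: topspace_stone_cech)
qed

lemma compose_in_unit_functions:
  assumes "continuous_map X Y f" "\<phi> \<in> unit_functions Y"
  shows "compose (topspace X) \<phi> f \<in> unit_functions X"
proof -
  have "continuous_map X (top_of_set {0..1}) (\<phi> \<circ> f)"
    using assms by (auto simp: unit_functions_def intro: continuous_map_compose)
  then have "continuous_map X (top_of_set {0..1}) (compose (topspace X) \<phi> f)"
    by (rule continuous_map_eq) (simp add: compose_def)
  then show ?thesis
    by (simp add: unit_functions_def compose_def)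
qed

lemma stone_cech_map_embed:
  assumes "continuous_map X Y f" "x \<in> topspace X"
  shows "stone_cech_map X Y f (stone_cech_embed X x) = stone_cech_embed Y (f x)"
proof
  fix \<phi>
  show "stone_cech_map X Y f (stone_cech_embed X x) \<phi> = stone_cech_embed Y (f x) \<phi>"
    using assms compose_in_unit_functions[OF assms(1), of \<phi>]
    by (simp add: stone_cech_map_def stone_cech_embed_def compose_def)
qed

lemma continuous_map_stone_cech_map:
  assumes f: "continuous_map X Y f"
  shows "continuous_map (stone_cech X) (stone_cech Y) (stone_cech_map X Y f)"
proof -
  have "continuous_map (stone_cech_cube X) (top_of_set {0..1}) (\<lambda>x. stone_cech_map X Y f x \<phi>)"
    if "\<phi> \<in> unit_functions Y" for \<phi>
    using that compose_in_unit_functions[OF f that]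
    by (auto simp: stone_cech_map_def stone_cech_cube_def intro: continuous_map_product_projection)
  then have cube: "continuous_map (stone_cech_cube X) (stone_cech_cube Y) (stone_cech_map X Y f)"
    unfolding stone_cech_cube_def[of Y] continuous_map_componentwise
    by (auto simp: stone_cech_map_def)
  have "f x \<in> topspace Y" if "x \<in> topspace X" for x
    using f that by (auto simp: continuous_map_def)
  then have "stone_cech_map X Y f ` (stone_cech_embed X ` topspace X) \<subseteq> stone_cech_embed Y ` topspace Y"
    using stone_cech_map_embed[OF f] by auto
  from closure_of_mono[OF this, of "stone_cech_cube Y"]
  have "stone_cech_map X Y f ` topspace (stone_cech X) \<subseteq> topspace (stone_cech Y)"
    using continuous_map_image_closure_subset[OF cube, of "stone_cech_embed X ` topspace X"]
    unfolding topspace_stone_cech by (rule order_trans[rotated])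
  moreover have "continuous_map (stone_cech X) (stone_cech_cube Y) (stone_cech_map X Y f)"
    unfolding stone_cech_def using cube by (rule continuous_map_from_subtopology)
  ultimately show ?thesis
    unfolding stone_cech_def[of Y] continuous_map_in_subtopology topspace_stone_cech
    by (simp add: image_subset_iff_funcset)
qed

lemma stone_cech_embed_homeomorphic:
  assumes "compact_space Y" "Hausdorff_space Y"
  shows "homeomorphic_map Y (stone_cech Y) (stone_cech_embed Y)"
proof (rule continuous_imp_homeomorphic_map)
  have "compactin (stone_cech Y) (stone_cech_embed Y ` topspace Y)"
    using assms(1) continuous_map_stone_cech_embed image_compactin compact_space_def by blast
  then have "closedin (stone_cech Y) (stone_cech_embed Y ` topspace Y)"
    using Hausdorff_space_stone_cech compactin_imp_closedin by blast
  then show "stone_cech_embed Y ` topspace Y = topspace (stone_cech Y)"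
    by (metis closure_of_closedin dense_stone_cech_embed)
  show "inj_on (stone_cech_embed Y) (topspace Y)"
  proof (rule inj_onI, rule ccontr)
    fix x y assume xy: "x \<in> topspace Y" "y \<in> topspace Y"
      and eq: "stone_cech_embed Y x = stone_cech_embed Y y" and "x \<noteq> y"
    have "completely_regular_space Y"
      using assms
      by (simp add: compact_Hausdorff_or_regular_imp_normal_space normal_imp_completely_regular_space_gen
          Hausdorff_imp_t1_space)
    moreover have "closedin Y {y}"
      by (rule closedin_Hausdorff_singleton[OF assms(2) xy(2)])
    moreover have "x \<in> topspace Y - {y}"
      using xy \<open>x \<noteq> y\<close> by simp
    ultimately have "\<exists>\<phi>::_\<Rightarrow>real. continuous_map Y (top_of_set {0..1}) \<phi> \<and> \<phi> x = 0 \<and> \<phi> ` {y} \<subseteq> {1}"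
      unfolding completely_regular_space_def by blast
    then obtain \<phi> where \<phi>: "continuous_map Y (top_of_set {0..1::real}) \<phi>" "\<phi> x = 0" "\<phi> y = 1"
      by auto
    define \<psi> where "\<psi> = restrict \<phi> (topspace Y)"
    have "\<psi> \<in> unit_functions Y"
      using \<phi>(1) by (auto simp: unit_functions_def \<psi>_def intro: continuous_map_eq)
    then have "\<psi> x = \<psi> y"
      using fun_cong[OF eq, of \<psi>] by (simp add: stone_cech_embed_def)
    then show False
      using xy \<phi> by (simp add: \<psi>_def)
  qed
qed (fact assms(1) Hausdorff_space_stone_cech continuous_map_stone_cech_embed)+

proposition stone_cech_universal:
  assumes "compact_space Y" "Hausdorff_space Y" "continuous_map X Y f"
  shows "\<exists>F. continuous_map (stone_cech X) Y F \<and>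
             (\<forall>x\<in>topspace X. F (stone_cech_embed X x) = f x)"
proof -
  obtain k where k: "homeomorphic_maps Y (stone_cech Y) (stone_cech_embed Y) k"
    using stone_cech_embed_homeomorphic[OF assms(1,2)] unfolding homeomorphic_map_maps ..
  then have cont_k: "continuous_map (stone_cech Y) Y k"
    and k_embed: "\<forall>y\<in>topspace Y. k (stone_cech_embed Y y) = y"
    unfolding homeomorphic_maps_def by simp_all
  show ?thesis
  proof (intro exI conjI ballI)
    show "continuous_map (stone_cech X) Y (k \<circ> stone_cech_map X Y f)"
      by (rule continuous_map_compose[OF continuous_map_stone_cech_map[OF assms(3)] cont_k])
    fix x assume x: "x \<in> topspace X"
    then have "f x \<in> topspace Y"
      using continuous_map_image_subset_topspace[OF assms(3)] by (simp add: image_subset_iff)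
    then show "(k \<circ> stone_cech_map X Y f) (stone_cech_embed X x) = f x"
      using k_embed by (simp add: stone_cech_map_embed[OF assms(3) x])
  qed
qed


section \<open>Actions\<close>

definition locally_compact_group :: "('g, 'm) monoid_scheme \<Rightarrow> 'g topology \<Rightarrow> bool" where
  "locally_compact_group G TG \<longleftrightarrow>
     group G \<and> topspace TG = carrier G \<and> locally_compact_space TG \<and> Hausdorff_space TG \<and>
     continuous_map (prod_topology TG TG) TG (\<lambda>(g, h). g \<otimes>\<^bsub>G\<^esub> h) \<and>
     continuous_map TG TG (m_inv G)"

definition continuous_right_action ::
  "('g, 'm) monoid_scheme \<Rightarrow> 'g topology \<Rightarrow> 'y topology \<Rightarrow> ('y \<Rightarrow> 'g \<Rightarrow> 'y) \<Rightarrow> bool" where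
  "continuous_right_action G TG TY act \<longleftrightarrow>
     locally_compact_group G TG \<and> locally_compact_space TY \<and> Hausdorff_space TY \<and>
     continuous_map (prod_topology TY TG) TY (\<lambda>(y, g). act y g) \<and>
     (\<forall>y\<in>topspace TY. act y \<one>\<^bsub>G\<^esub> = y) \<and>
     (\<forall>y\<in>topspace TY. \<forall>g\<in>carrier G. \<forall>h\<in>carrier G. act (act y g) h = act y (g \<otimes>\<^bsub>G\<^esub> h))"

definition conditionally_negative_type ::
  "('g, 'm) monoid_scheme \<Rightarrow> 'y set \<Rightarrow> ('y \<Rightarrow> 'g \<Rightarrow> 'y) \<Rightarrow> ('y \<times> 'g \<Rightarrow> real) \<Rightarrow> bool" where
  "conditionally_negative_type G Y act h \<longleftrightarrow>
     (\<forall>y\<in>Y. h (y, \<one>\<^bsub>G\<^esub>) = 0) \<and>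
     (\<forall>y\<in>Y. \<forall>g\<in>carrier G. h (y, g) = h (act y g, inv\<^bsub>G\<^esub> g)) \<and>
     (\<forall>y\<in>Y. \<forall>(n::nat) (g :: nat \<Rightarrow> 'g) (t :: nat \<Rightarrow> real).
        (\<forall>i<n. g i \<in> carrier G) \<and> (\<Sum>i<n. t i) = 0 \<longrightarrow>
        (\<Sum>i<n. \<Sum>j<n. t i * t j * h (act y (g i), inv\<^bsub>G\<^esub> (g i) \<otimes>\<^bsub>G\<^esub> g j)) \<le> 0)"

definition locally_proper ::
  "('g, 'm) monoid_scheme \<Rightarrow> 'g topology \<Rightarrow> 'y topology \<Rightarrow> ('y \<Rightarrow> 'g \<Rightarrow> 'y) \<Rightarrow> ('y \<times> 'g \<Rightarrow> real) \<Rightarrow> bool"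
where
  "locally_proper G TG TY act h \<longleftrightarrow>
     (\<forall>K. compactin TY K \<longrightarrow>
        proper_map
          (subtopology (prod_topology TY TG) {(y, g). y \<in> K \<and> g \<in> carrier G \<and> act y g \<in> K})
          euclideanreal h)"

text \<open>That \<open>act\<close> is a continuous right action of a locally compact group on a locally compact
  Hausdorff space is part of the notion.\<close>

definition a_T_menable_action ::
  "('g, 'm) monoid_scheme \<Rightarrow> 'g topology \<Rightarrow> 'y topology \<Rightarrow> ('y \<Rightarrow> 'g \<Rightarrow> 'y) \<Rightarrow> bool" where
  "a_T_menable_action G TG TY act \<longleftrightarrow>
     continuous_right_action G TG TY act \<and>
     (\<exists>h. continuous_map (prod_topology TY TG) euclideanreal h \<and>
          conditionally_negative_type G (topspace TY) act h \<and>
          locally_proper G TG TY act h)"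


section \<open>The boundary piece determined by a subset of the group\<close>

definition beta :: "('g, 'm) monoid_scheme \<Rightarrow> (('g \<Rightarrow> real) \<Rightarrow> real) topology" where
  "beta G = stone_cech (discrete_topology (carrier G))"

definition beta_embed :: "('g, 'm) monoid_scheme \<Rightarrow> 'g \<Rightarrow> (('g \<Rightarrow> real) \<Rightarrow> real)" where
  "beta_embed G = stone_cech_embed (discrete_topology (carrier G))"

definition beta_boundary :: "('g, 'm) monoid_scheme \<Rightarrow> (('g \<Rightarrow> real) \<Rightarrow> real) set" where
  "beta_boundary G = topspace (beta G) - beta_embed G ` carrier G"

definition boundary_piece ::
  "('g, 'm) monoid_scheme \<Rightarrow> 'g set \<Rightarrow> 'g set \<Rightarrow> (('g \<Rightarrow> real) \<Rightarrow> real) set" where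
  "boundary_piece G S Z =
     (\<Union>R::nat. beta G closure_of (beta_embed G ` nbhd G S (real R) Z)) \<inter> beta_boundary G"

text \<open>The continuous extension of right multiplication by \<open>g\<close> from the discrete group to its
  compactification.\<close>

definition beta_right_mult ::
  "('g, 'm) monoid_scheme \<Rightarrow> (('g \<Rightarrow> real) \<Rightarrow> real) \<Rightarrow> 'g \<Rightarrow> (('g \<Rightarrow> real) \<Rightarrow> real)" where
  "beta_right_mult G y g =
     stone_cech_map (discrete_topology (carrier G)) (discrete_topology (carrier G)) (\<lambda>x. x \<otimes>\<^bsub>G\<^esub> g) y"

end

theory Submission
  imports Defs
begin

text \<open>
  For a group element \<open>x\<close> let \<open>near x\<close> be a point of the box space whose image in the group is closest
  to \<open>x\<close>. The function of conditionally negative type is the limit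
  \<open>h (y, g) = lim d (near x, near (x g))\<close> as \<open>x\<close> tends to \<open>y\<close>. Three facts make this work.

  \<^item> A point \<open>y\<close> of the Stone-Cech compactification of a discrete space is an ultrafilter, and ``\<open>P x\<close>
  for all \<open>x\<close> near \<open>y\<close>'' is the statement \<open>eventually P (ultrafilter y)\<close>. For \<open>y\<close> in the boundary
  piece, \<open>x\<close> stays within some distance \<open>R\<close> of \<open>Z\<close> near \<open>y\<close>, so \<open>x\<close> and \<open>x g\<close> are both at bounded
  distance from \<open>Z\<close> and the coarse embedding bounds \<open>d (near x, near (x g))\<close>. As \<open>y\<close> is not a group
  element, \<open>x\<close> leaves every finite set; balls of the word metric are finite, so \<open>near x\<close> leaves every
  component. Far out, bounded distance forces \<open>near x\<close> and \<open>near (x g)\<close> into the same component, and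
  there the distance is an integer. Hence \<open>d (near x, near (x g))\<close> is constant near \<open>y\<close>; the limit
  exists, and it is locally constant in \<open>y\<close>.

  \<^item> Conditional negativity at \<open>y\<close> for finitely many \<open>g i\<close> is a statement about the points
  \<open>near (x * g i)\<close> for one suitable \<open>x\<close>. They have mutually bounded distances in a single graph whose
  girth is arbitrarily large, and there the edge metric is a tree metric: rooting at one of the
  points, the distance of two vertices is the number of vertices that lie on exactly one of the two
  geodesics to the root (\<open>rooted_graph.edge_dist_eq_card_ancestors\<close>). Such a kernel is a squared
  Hilbert space distance, hence conditionally negative (\<open>sum_sym_diff_nonpos\<close>).

  \<^item> A compact \<open>K\<close> lies in the closure of one neighbourhood of \<open>Z\<close> of radius \<open>R\<close>. If \<open>y\<close> and \<open>y g\<close>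
  are in \<open>K\<close>, then \<open>x\<close> and \<open>x g\<close> are within \<open>R\<close> of \<open>Z\<close> for \<open>x\<close> near \<open>y\<close>, so a bound on \<open>h (y, g)\<close>
  bounds the length of \<open>g\<close>. This leaves finitely many \<open>g\<close> and gives local properness.
\<close>


section \<open>Large girth makes bounded pieces of a graph tree-like\<close>

definition walk :: "('v \<times> 'v) set \<Rightarrow> nat \<Rightarrow> (nat \<Rightarrow> 'v) \<Rightarrow> bool" where
  "walk E k w \<longleftrightarrow> (\<forall>i<k. (w i, w (Suc i)) \<in> E)"

definition reduced :: "nat \<Rightarrow> (nat \<Rightarrow> 'v) \<Rightarrow> bool" where
  "reduced k w \<longleftrightarrow> (\<forall>i. i + 2 \<le> k \<longrightarrow> w i \<noteq> w (i + 2))"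

lemma girth_le_cycle: "is_cycle E c \<Longrightarrow> girth E \<le> enat (length c)"
  unfolding girth_def by (rule INF_lower) simp

text \<open>A shortest closed piece of the walk has pairwise distinct vertices; it is not an edge traversed
  twice because the walk is reduced, so it is a cycle.\<close>
lemma reduced_walk_not_closed:
  assumes "irrefl E" "walk E k w" "reduced k w" "0 < k" "enat k < girth E"
  shows "w 0 \<noteq> w k"
proof
  assume closed: "w 0 = w k"
  \<comment> \<open>\<open>Q l\<close> says that the walk contains a closed piece of length \<open>l\<close>.\<close>
  define Q where "Q = (\<lambda>l. \<exists>i. 0 < l \<and> i + l \<le> k \<and> w i = w (i + l))"
  define l where "l = (LEAST l. Q l)"
  have "Q k"
    using closed \<open>0 < k\<close> by (auto simp: Q_def intro!: exI[of _ 0])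
  then have "Q l"
    unfolding l_def by (rule LeastI)
  then obtain i where i: "0 < l" "i + l \<le> k" "w i = w (i + l)"
    by (auto simp: Q_def)
  have least: "\<not> Q m" if "m < l" for m
    using that not_less_Least unfolding l_def by blast
  have "l \<noteq> 1"
  proof
    assume "l = 1"
    then have "(w i, w i) \<in> E"
      using assms(2) i by (metis One_nat_def add_Suc_right add.right_neutral less_eq_Suc_le walk_def)
    then show False
      using assms(1) by (auto simp: irrefl_def)
  qed
  moreover have "l \<noteq> 2"
    using i assms(3) by (auto simp: reduced_def)
  ultimately have "3 \<le> l"
    using i by linarith
  have distinct: "inj_on w {i..<i + l}"
  proof (rule linorder_inj_onI)
    fix a b assume ab: "a < b" "a \<in> {i..<i + l}" "b \<in> {i..<i + l}"
    then have "0 < b - a" "b - a < l" "a + (b - a) \<le> k" "a + (b - a) = b"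
      using i(2) by auto
    then show "w a \<noteq> w b"
      using least[of "b - a"] unfolding Q_def by metis
  qed auto
  have "is_cycle E (map w [i..<i + l])"
    unfolding is_cycle_def
  proof (intro conjI)
    show "3 \<le> length (map w [i..<i + l])"
      using \<open>3 \<le> l\<close> by simp
    show "distinct (map w [i..<i + l])"
      using distinct by (simp add: distinct_map)
    show "successively (\<lambda>u v. (u, v) \<in> E) (map w [i..<i + l])"
      using assms(2) i(2) by (auto simp: successively_conv_nth walk_def)
    have "i + l - 1 < k" "Suc (i + l - 1) = i + l"
      using i(1,2) by auto
    then have "(w (i + l - 1), w (i + l)) \<in> E"
      using assms(2) unfolding walk_def by metis
    then show "(last (map w [i..<i + l]), hd (map w [i..<i + l])) \<in> E"
      using i(1,3) by (simp add: last_map hd_map)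
  qed
  then have "girth E \<le> enat l"
    using girth_le_cycle by fastforce
  then show False
    using assms(5) i(2) by (meson enat_ord_simps(1) le_add2 leD order_trans)
qed

text \<open>If the first steps differed, then following one walk backwards and the other one forwards would
  be a reduced closed walk of length below the girth.\<close>
lemma reduced_walks_same_start:
  assumes "irrefl E" "sym E"
    and v: "walk E k v" "reduced k v" and w: "walk E m w" "reduced m w"
    and ends: "v 0 = w 0" "v k = w m"
    and pos: "0 < k" "0 < m" and girth: "enat (k + m) < girth E"
  shows "v 1 = w 1"
proof (rule ccontr)
  assume ne: "v 1 \<noteq> w 1"
  define c where "c i = (if i \<le> k then v (k - i) else w (i - k))" for i
  have "walk E (k + m) c"
    unfolding walk_def
  proof (intro allI impI)
    fix i assume "i < k + m"
    consider "i < k" | "i = k" | "k < i"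
      by linarith
    then show "(c i, c (Suc i)) \<in> E"
    proof cases
      case 1
      then have "(v (k - Suc i), v (Suc (k - Suc i))) \<in> E"
        using v(1) unfolding walk_def by simp
      then show ?thesis
        using 1 \<open>sym E\<close> by (auto simp: c_def Suc_diff_Suc dest: symD)
    next
      case 2
      then show ?thesis
        using w(1) pos ends(1) by (simp add: c_def walk_def)
    next
      case 3
      then show ?thesis
        using w(1) \<open>i < k + m\<close> by (simp add: c_def walk_def Suc_diff_le)
    qed
  qed
  moreover have "reduced (k + m) c"
    unfolding reduced_def
  proof (intro allI impI)
    fix i assume i: "i + 2 \<le> k + m"
    consider "i + 2 \<le> k" | "i + 1 = k" | "k \<le> i"
      by linarith
    then show "c i \<noteq> c (i + 2)"
    proof cases
      case 1
      then have "v (k - (i + 2)) \<noteq> v (k - (i + 2) + 2)"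
        using v(2) unfolding reduced_def by simp
      moreover have "k - (i + 2) + 2 = k - i"
        using 1 by simp
      ultimately show ?thesis
        using 1 by (simp add: c_def)
    next
      case 2
      then have "k - i = 1" "i + 2 - k = 1"
        by auto
      then show ?thesis
        using 2 ne by (simp add: c_def)
    next
      case 3
      then have "w (i - k) \<noteq> w (i - k + 2)"
        using w(2) i unfolding reduced_def by simp
      then show ?thesis
        using 3 ends(1) by (cases "i = k") (simp_all add: c_def Suc_diff_le numeral_2_eq_2)
    qed
  qed
  ultimately have "c 0 \<noteq> c (k + m)"
    using reduced_walk_not_closed[OF assms(1)] girth pos by simp
  then show False
    using ends pos by (simp add: c_def)
qed

lemma edge_dist_le: "(u, v) \<in> E ^^ k \<Longrightarrow> edge_dist E u v \<le> k"
  unfolding edge_dist_def by (rule Least_le)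

lemma edge_dist_walk:
  assumes "finite_connected_graph V E" "u \<in> V" "v \<in> V"
  shows "(u, v) \<in> E ^^ edge_dist E u v"
proof -
  have "(u, v) \<in> E\<^sup>*"
    using assms unfolding finite_connected_graph_def by blast
  then have "\<exists>k. (u, v) \<in> E ^^ k"
    using rtrancl_power by blast
  then show ?thesis
    unfolding edge_dist_def by (rule LeastI_ex)
qed

lemma edge_dist_eq_0_iff:
  assumes "finite_connected_graph V E" "u \<in> V" "v \<in> V"
  shows "edge_dist E u v = 0 \<longleftrightarrow> u = v"
  using edge_dist_walk[OF assms] edge_dist_le[of u v 0 E] by auto

lemma edge_dist_edge_le:
  assumes "finite_connected_graph V E" "(u, v) \<in> E" "x \<in> V"
  shows "edge_dist E u x \<le> Suc (edge_dist E v x)"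
proof -
  have "v \<in> V"
    using assms(1,2) unfolding finite_connected_graph_def by blast
  then have "(u, x) \<in> E ^^ Suc (edge_dist E v x)"
    using edge_dist_walk[OF assms(1) _ assms(3)] assms(2) by (meson relpow_Suc_I2)
  then show ?thesis
    by (rule edge_dist_le)
qed

lemma card_sym_diff_triangle:
  assumes "finite A" "finite B" "finite C"
  shows "card (sym_diff A C) \<le> card (sym_diff A B) + card (sym_diff B C)"
proof -
  have "card (sym_diff A C) \<le> card (sym_diff A B \<union> sym_diff B C)"
    using assms by (intro card_mono finite_UnI finite_Diff) blast+
  also have "\<dots> \<le> card (sym_diff A B) + card (sym_diff B C)"
    by (rule card_Un_le)
  finally show ?thesis .
qed
text \<open>Choosing one parent for every vertex gives a spanning tree of geodesics to the root. Up to half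
  the girth this tree contains all edges, so there the edge metric is the metric of the tree.\<close>
locale rooted_graph =
  fixes V :: "'v set" and E :: "('v \<times> 'v) set" and root :: 'v
  assumes graph: "finite_connected_graph V E" and root: "root \<in> V"
begin

definition depth :: "'v \<Rightarrow> nat" where
  "depth v = edge_dist E v root"

definition parent :: "'v \<Rightarrow> 'v" where
  "parent v = (SOME u. (v, u) \<in> E \<and> Suc (depth u) = depth v)"

text \<open>The vertex itself counts as an ancestor and the root does not, so that a vertex has exactly as
  many ancestors as its depth.\<close>
definition ancestors :: "'v \<Rightarrow> 'v set" where
  "ancestors v = (\<lambda>i. (parent ^^ i) v) ` {..<depth v}"

lemma edge_in_V: "(u, v) \<in> E \<Longrightarrow> u \<in> V \<and> v \<in> V"
  using graph unfolding finite_connected_graph_def by blast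

lemma sym_E: "sym E" and irrefl_E: "irrefl E"
  using graph unfolding finite_connected_graph_def by auto

lemma depth_edge: "(u, v) \<in> E \<Longrightarrow> depth u \<le> Suc (depth v)"
  unfolding depth_def using edge_dist_edge_le[OF graph _ root] .

lemma depth_eq_0_iff: "v \<in> V \<Longrightarrow> depth v = 0 \<longleftrightarrow> v = root"
  unfolding depth_def by (rule edge_dist_eq_0_iff[OF graph _ root])

lemma parent:
  assumes "v \<in> V" "0 < depth v"
  shows "(v, parent v) \<in> E" "depth v = Suc (depth (parent v))" "parent v \<in> V"
proof -
  have "(v, root) \<in> E ^^ depth v"
    unfolding depth_def by (rule edge_dist_walk[OF graph assms(1) root])
  then obtain u where u: "(v, u) \<in> E" "(u, root) \<in> E ^^ (depth v - 1)"
    using assms(2) by (metis Suc_pred' relpow_Suc_D2)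
  then have "Suc (depth u) = depth v"
    using edge_dist_le[OF u(2)] depth_edge[OF u(1)] assms(2) unfolding depth_def by linarith
  then have "(v, parent v) \<in> E \<and> Suc (depth (parent v)) = depth v"
    unfolding parent_def using u(1) by (metis (mono_tags, lifting) someI_ex)
  then show "(v, parent v) \<in> E" "depth v = Suc (depth (parent v))" "parent v \<in> V"
    using edge_in_V by auto
qed

lemma parent_iterate:
  assumes "v \<in> V" "i \<le> depth v"
  shows "(parent ^^ i) v \<in> V \<and> depth ((parent ^^ i) v) = depth v - i"
  using assms(2)
proof (induction i)
  case (Suc i)
  then have "(parent ^^ i) v \<in> V \<and> depth ((parent ^^ i) v) = depth v - i"
    by simp
  then show ?case
    using parent[of "(parent ^^ i) v"] Suc.prems by simp
qed (use assms in simp)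

lemma ancestors_root: "depth v = 0 \<Longrightarrow> ancestors v = {}"
  by (simp add: ancestors_def)

lemma finite_ancestors: "finite (ancestors v)"
  by (simp add: ancestors_def)

lemma depth_ancestor_less: "v \<in> V \<Longrightarrow> u \<in> ancestors v \<Longrightarrow> u = v \<or> depth u < depth v"
proof -
  assume v: "v \<in> V" "u \<in> ancestors v"
  then obtain i where "i < depth v" "u = (parent ^^ i) v"
    by (auto simp: ancestors_def)
  then show ?thesis
    using parent_iterate[OF v(1), of i] by (cases i) auto
qed

lemma ancestors_parent:
  assumes "v \<in> V" "0 < depth v"
  shows "ancestors v = insert v (ancestors (parent v))" "v \<notin> ancestors (parent v)"
proof -
  have "{..<depth v} = insert 0 (Suc ` {..<depth (parent v)})"
    using parent(2)[OF assms] by (simp add: lessThan_Suc_eq_insert_0)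
  then show "ancestors v = insert v (ancestors (parent v))"
    unfolding ancestors_def by (simp add: image_image funpow_swap1 del: funpow.simps(2))
       (simp add: funpow_Suc_right del: funpow.simps(2))
  show "v \<notin> ancestors (parent v)"
    using depth_ancestor_less[OF parent(3)[OF assms], of v] parent(2)[OF assms] by auto
qed

lemma walk_to_root:
  assumes "v \<in> V"
  shows "walk E (depth v) (\<lambda>i. (parent ^^ i) v)" "reduced (depth v) (\<lambda>i. (parent ^^ i) v)"
    "(parent ^^ depth v) v = root"
proof -
  show "walk E (depth v) (\<lambda>i. (parent ^^ i) v)"
    unfolding walk_def using parent_iterate[OF assms] parent(1) by simp
  show "reduced (depth v) (\<lambda>i. (parent ^^ i) v)"
    unfolding reduced_def
  proof (intro allI impI)
    fix i assume i: "i + 2 \<le> depth v"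
    then have "depth ((parent ^^ i) v) = depth v - i" "depth ((parent ^^ (i + 2)) v) = depth v - (i + 2)"
      using parent_iterate[OF assms] by (meson add_leD1)+
    with i show "(parent ^^ i) v \<noteq> (parent ^^ (i + 2)) v"
      by (metis add.commute add_diff_cancel_left' diff_diff_cancel add_leD1 add_cancel_right_right zero_neq_numeral)
  qed
  show "(parent ^^ depth v) v = root"
    using parent_iterate[OF assms, of "depth v"] depth_eq_0_iff[of "(parent ^^ depth v) v"] by simp
qed

text \<open>Prefixing the geodesic of \<open>v\<close> with an edge \<open>(u, v)\<close> outside the tree gives a second reduced walk
  from \<open>u\<close> to the root, besides the geodesic of \<open>u\<close>. Both are too short to differ in their first
  step.\<close>
lemma edge_is_parental:
  assumes e: "(u, v) \<in> E" and u: "0 < depth u" and girth: "enat (depth u + Suc (depth v)) < girth E"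
  shows "parent u = v \<or> 0 < depth v \<and> parent v = u"
proof (rule ccontr)
  assume neg: "\<not> (parent u = v \<or> 0 < depth v \<and> parent v = u)"
  have V: "u \<in> V" "v \<in> V"
    using edge_in_V[OF e] by auto
  define w where "w i = (case i of 0 \<Rightarrow> u | Suc j \<Rightarrow> (parent ^^ j) v)" for i
  have "walk E (Suc (depth v)) w"
    using walk_to_root(1)[OF V(2)] e unfolding walk_def w_def by (auto split: nat.split)
  moreover have "reduced (Suc (depth v)) w"
    using walk_to_root(2)[OF V(2)] neg unfolding reduced_def w_def
    by (auto split: nat.split simp: numeral_2_eq_2)
  moreover have "w (Suc (depth v)) = root"
    by (simp add: w_def walk_to_root(3)[OF V(2)])
  moreover have "w 0 = u"
    by (simp add: w_def)
  ultimately have "parent u = w 1"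
    using reduced_walks_same_start[OF irrefl_E sym_E walk_to_root(1,2)[OF V(1)], of "Suc (depth v)" w]
      walk_to_root(3)[OF V(1)] u girth by simp
  then show False
    using neg by (simp add: w_def)
qed

lemma card_ancestors_edge:
  assumes e: "(u, v) \<in> E" and girth: "enat (depth u + Suc (depth v)) < girth E"
  shows "card (sym_diff (ancestors u) (ancestors v)) \<le> 1"
proof -
  have V: "u \<in> V" "v \<in> V"
    using edge_in_V[OF e] by auto
  have single: "card (sym_diff (ancestors a) (ancestors (parent a))) \<le> 1"
      "card (sym_diff (ancestors (parent a)) (ancestors a)) \<le> 1"
    if "a \<in> V" "0 < depth a" for a
  proof -
    have "sym_diff (ancestors a) (ancestors (parent a)) \<subseteq> {a}"
      "sym_diff (ancestors (parent a)) (ancestors a) \<subseteq> {a}"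
      using ancestors_parent[OF that] by auto
    from this[THEN card_mono[rotated]] show "card (sym_diff (ancestors a) (ancestors (parent a))) \<le> 1"
      "card (sym_diff (ancestors (parent a)) (ancestors a)) \<le> 1"
      by auto
  qed
  consider "0 < depth u" | "depth u = 0" "0 < depth v" | "depth u = 0" "depth v = 0"
    by blast
  then show ?thesis
  proof cases
    case 1
    then show ?thesis
      using edge_is_parental[OF e 1 girth] single V by auto
  next
    case 2
    have "(v, u) \<in> E"
      using e sym_E by (auto dest: symD)
    moreover have "enat (depth v + Suc (depth u)) < girth E"
      using girth by (simp add: add.commute)
    ultimately have "parent v = u"
      using edge_is_parental[of v u] 2 by auto
    then show ?thesis
      using single[of v] 2 V by auto
  next
    case 3
    then show ?thesis
      by (simp add: ancestors_root)
  qed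
qed

text \<open>Each edge of a walk that stays close to the root changes the set of ancestors by at most one vertex.\<close>
lemma card_ancestors_le_walk:
  assumes girth: "enat (2 * N + 1) < girth E"
  shows "(u, v) \<in> E ^^ k \<Longrightarrow> depth v + k \<le> N \<Longrightarrow> card (sym_diff (ancestors u) (ancestors v)) \<le> k
           \<and> depth u \<le> depth v + k"
proof (induction k arbitrary: u)
  case (Suc k)
  then obtain x where x: "(u, x) \<in> E" "(x, v) \<in> E ^^ k"
    by (metis relpow_Suc_D2)
  then have IH: "card (sym_diff (ancestors x) (ancestors v)) \<le> k" "depth x \<le> depth v + k"
    using Suc by auto
  moreover have "depth u \<le> Suc (depth x)"
    using x(1) by (rule depth_edge)
  moreover have "enat (depth u + Suc (depth x)) \<le> enat (2 * N + 1)"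
    using Suc.prems(2) calculation by simp
  then have "enat (depth u + Suc (depth x)) < girth E"
    using girth by (rule order.strict_trans1)
  then have "card (sym_diff (ancestors u) (ancestors x)) \<le> 1"
    using card_ancestors_edge x(1) by blast
  ultimately show ?case
    using card_sym_diff_triangle[OF finite_ancestors finite_ancestors finite_ancestors, of u v x] by linarith
qed simp

lemma edge_dist_sym: "u \<in> V \<Longrightarrow> v \<in> V \<Longrightarrow> edge_dist E u v = edge_dist E v u"
proof -
  have "E ^^ k = (E ^^ k)\<inverse>" for k
  proof (induction k)
    case (Suc k)
    have "(E ^^ Suc k)\<inverse> = E\<inverse> O (E ^^ k)\<inverse>"
      by (simp add: converse_relcomp)
    also have "\<dots> = E O E ^^ k"
      using sym_E Suc.IH by (metis sym_conv_converse_eq)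
    finally show ?case
      by (simp add: relpow_commute)
  qed simp
  then have "(u, v) \<in> E ^^ k \<longleftrightarrow> (v, u) \<in> E ^^ k" for k
    by blast
  then show ?thesis
    unfolding edge_dist_def by simp
qed

text \<open>This is the length of the path through the tree. Of two distinct vertices at least one, different
  from the root, is not an ancestor of the other; passing from it to its parent is an edge and removes
  exactly this vertex from the symmetric difference.\<close>
lemma edge_dist_le_card_ancestors:
  assumes "u \<in> V" "v \<in> V"
  shows "edge_dist E u v \<le> card (sym_diff (ancestors u) (ancestors v))"
  using assms
proof (induction "depth u + depth v" arbitrary: u v rule: less_induct)
  case less
  have step: "edge_dist E a b \<le> card (sym_diff (ancestors a) (ancestors b))"
    if ab: "a \<in> V" "b \<in> V" "depth a + depth b = depth u + depth v" and a: "a \<in> ancestors a" "a \<notin> ancestors b"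
    for a b
  proof -
    have pos: "0 < depth a"
      using a(1) ancestors_root by fastforce
    note p = parent[OF ab(1) pos] and anc = ancestors_parent[OF ab(1) pos]
    have "sym_diff (ancestors a) (ancestors b) = insert a (sym_diff (ancestors (parent a)) (ancestors b))"
      "a \<notin> sym_diff (ancestors (parent a)) (ancestors b)"
      using anc a by auto
    then have "card (sym_diff (ancestors a) (ancestors b)) =
        Suc (card (sym_diff (ancestors (parent a)) (ancestors b)))"
      by (simp add: finite_ancestors)
    moreover have "edge_dist E (parent a) b \<le> card (sym_diff (ancestors (parent a)) (ancestors b))"
      using less.hyps[of "parent a" b] ab p by simp
    moreover have "edge_dist E a b \<le> Suc (edge_dist E (parent a) b)"
      using edge_dist_edge_le[OF graph p(1) ab(2)] .
    ultimately show ?thesis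
      by linarith
  qed
  have self: "x \<in> ancestors x" if "x \<in> V" "0 < depth x" for x
    using ancestors_parent(1)[OF that] by blast
  have flip: "sym_diff (ancestors v) (ancestors u) = sym_diff (ancestors u) (ancestors v)"
    by blast
  consider "u = v" | "0 < depth u" "u \<notin> ancestors v" | "0 < depth v" "v \<notin> ancestors u"
    using less.prems depth_ancestor_less[of u v] depth_ancestor_less[of v u] depth_eq_0_iff
    by (metis not_less_iff_gr_or_eq not_gr_zero)
  then show ?case
  proof cases
    case 1
    then show ?thesis
      using edge_dist_eq_0_iff[OF graph] less.prems by auto
  next
    case 2
    then show ?thesis
      using step[of u v] self less.prems by simp
  next
    case 3
    then show ?thesis
      using step[of v u] self less.prems flip edge_dist_sym by (simp add: add.commute)
  qed
qed

lemma edge_dist_eq_card_ancestors: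
  assumes "u \<in> V" "v \<in> V" "depth v + edge_dist E u v \<le> N" "enat (2 * N + 1) < girth E"
  shows "edge_dist E u v = card (sym_diff (ancestors u) (ancestors v))"
  using edge_dist_le_card_ancestors[OF assms(1,2)]
    card_ancestors_le_walk[OF assms(4) edge_dist_walk[OF graph assms(1,2)] assms(3)] by linarith

end

text \<open>The cardinality of a symmetric difference is the squared distance of two indicator functions. As
  the weights add up to zero, only the mixed terms survive, and they form minus twice a sum of squares.\<close>
lemma sum_sym_diff_nonpos:
  fixes t :: "'i \<Rightarrow> real" and P :: "'i \<Rightarrow> 'a set"
  assumes "finite I" "\<And>i. i \<in> I \<Longrightarrow> finite (P i)" "sum t I = 0"
  shows "(\<Sum>i\<in>I. \<Sum>j\<in>I. t i * t j * real (card (sym_diff (P i) (P j)))) \<le> 0"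
proof -
  define U where "U = (\<Union>i\<in>I. P i)"
  have "finite U"
    using assms by (simp add: U_def)
  define c where "c i x = (of_bool (x \<in> P i) :: real)" for i x
  have card: "real (card (sym_diff (P i) (P j))) = (\<Sum>x\<in>U. c i x + c j x - 2 * (c i x * c j x))"
    if "i \<in> I" "j \<in> I" for i j
  proof -
    have "real (card (sym_diff (P i) (P j))) = (\<Sum>x\<in>U. of_bool (x \<in> sym_diff (P i) (P j)))"
      using that \<open>finite U\<close> by (subst sum_of_bool_eq) (auto simp: U_def intro!: arg_cong[where f = card])
    also have "\<dots> = (\<Sum>x\<in>U. c i x + c j x - 2 * (c i x * c j x))"
      by (rule sum.cong) (auto simp: c_def)
    finally show ?thesis .
  qed
  have "(\<Sum>i\<in>I. \<Sum>j\<in>I. t i * t j * real (card (sym_diff (P i) (P j))))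
      = (\<Sum>i\<in>I. \<Sum>j\<in>I. \<Sum>x\<in>U. t i * t j * (c i x + c j x - 2 * (c i x * c j x)))"
    by (simp add: card sum_distrib_left)
  also have "\<dots> = (\<Sum>i\<in>I. \<Sum>x\<in>U. \<Sum>j\<in>I. t i * t j * (c i x + c j x - 2 * (c i x * c j x)))"
    by (intro sum.cong refl sum.swap)
  also have "\<dots> = (\<Sum>x\<in>U. \<Sum>i\<in>I. \<Sum>j\<in>I. t i * t j * (c i x + c j x - 2 * (c i x * c j x)))"
    by (rule sum.swap)
  also have "\<dots> = (\<Sum>x\<in>U. - 2 * (\<Sum>i\<in>I. t i * c i x)\<^sup>2)"
  proof (rule sum.cong)
    fix x
    have "(\<Sum>i\<in>I. \<Sum>j\<in>I. t i * t j * (c i x + c j x - 2 * (c i x * c j x)))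
        = (\<Sum>i\<in>I. \<Sum>j\<in>I. (t i * c i x) * t j) + (\<Sum>i\<in>I. \<Sum>j\<in>I. t i * (t j * c j x))
          - 2 * (\<Sum>i\<in>I. \<Sum>j\<in>I. (t i * c i x) * (t j * c j x))"
      by (simp add: algebra_simps sum.distrib sum_subtractf sum_distrib_left)
    also have "\<dots> = - 2 * (\<Sum>i\<in>I. t i * c i x)\<^sup>2"
      by (simp add: assms(3) power2_eq_square flip: sum_product)
    finally show "(\<Sum>i\<in>I. \<Sum>j\<in>I. t i * t j * (c i x + c j x - 2 * (c i x * c j x)))
        = - 2 * (\<Sum>i\<in>I. t i * c i x)\<^sup>2" .
  qed simp
  also have "\<dots> \<le> 0"
    by (intro sum_nonpos) simp
  finally show ?thesis .
qed

text \<open>Rooted at one of the points, all points have depth at most \<open>D\<close>, and geodesics between them stay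
  within depth \<open>2 * D\<close>; this is the radius in which the graph has to look like a tree.\<close>
lemma edge_dist_conditionally_negative:
  fixes t :: "'i \<Rightarrow> real" and v :: "'i \<Rightarrow> 'v"
  assumes graph: "finite_connected_graph V E"
    and I: "finite I" "\<And>i. i \<in> I \<Longrightarrow> v i \<in> V"
    and bound: "\<And>i j. i \<in> I \<Longrightarrow> j \<in> I \<Longrightarrow> edge_dist E (v i) (v j) \<le> D"
    and girth: "enat (4 * D + 1) < girth E"
    and sum: "sum t I = 0"
  shows "(\<Sum>i\<in>I. \<Sum>j\<in>I. t i * t j * real (edge_dist E (v i) (v j))) \<le> 0"
proof (cases "I = {}")
  case False
  then obtain k where k: "k \<in> I"
    by blast
  interpret rooted_graph V E "v k"
    using graph I(2)[OF k] by unfold_locales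
  have "edge_dist E (v i) (v j) = card (sym_diff (ancestors (v i)) (ancestors (v j)))"
    if "i \<in> I" "j \<in> I" for i j
  proof (rule edge_dist_eq_card_ancestors)
    show "depth (v j) + edge_dist E (v i) (v j) \<le> 2 * D"
      using bound[OF that] bound[OF that(2) k] unfolding depth_def by linarith
    show "enat (2 * (2 * D) + 1) < girth E"
      using girth by simp
  qed (use I that in auto)
  then show ?thesis
    using sum_sym_diff_nonpos[OF I(1), of "\<lambda>i. ancestors (v i)" t] sum finite_ancestors by simp
qed simp


section \<open>The word metric\<close>

locale word_metric = group G for G :: "('g, 'm) monoid_scheme" (structure) +
  fixes S :: "'g set"
  assumes generators: "finite_generating_set G S"
begin

abbreviation letters :: "'g set" where
  "letters \<equiv> S \<union> m_inv G ` S"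

abbreviation word_prod :: "'g list \<Rightarrow> 'g" where
  "word_prod ws \<equiv> foldr (\<otimes>) ws \<one>"

lemma letters_closed: "letters \<subseteq> carrier G"
  using generators by (auto simp: finite_generating_set_def)

lemma finite_letters: "finite letters"
  using generators by (simp add: finite_generating_set_def)

lemma inv_letter: "a \<in> letters \<Longrightarrow> inv a \<in> letters"
  using generators unfolding finite_generating_set_def by auto

lemma word_prod_closed: "set ws \<subseteq> letters \<Longrightarrow> word_prod ws \<in> carrier G"
  using letters_closed by (induction ws) auto

lemma word_prod_append:
  "set ws \<subseteq> letters \<Longrightarrow> set vs \<subseteq> letters \<Longrightarrow> word_prod (ws @ vs) = word_prod ws \<otimes> word_prod vs"
proof (induction ws)
  case (Cons a ws)
  then have "a \<in> carrier G"
    using letters_closed by auto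
  then show ?case
    using Cons word_prod_closed by (simp add: m_assoc)
qed (simp add: word_prod_closed)

lemma word_prod_inv:
  "set ws \<subseteq> letters \<Longrightarrow> word_prod (rev (map (m_inv G) ws)) = inv (word_prod ws)"
proof (induction ws)
  case (Cons a ws)
  then have a: "a \<in> carrier G" "inv a \<in> letters"
    using letters_closed inv_letter by auto
  have rev: "set (rev (map (m_inv G) ws)) \<subseteq> letters"
    using inv_letter Cons.prems by fastforce
  have "word_prod (rev (map (m_inv G) (a # ws))) = inv (word_prod ws) \<otimes> inv a"
    using word_prod_append[OF rev, of "[inv a]"] a Cons by simp
  then show ?case
    using a Cons.prems word_prod_closed by (simp add: inv_mult_group)
qed simp

text \<open>The word length is a least number, so it carries information only because some word exists.\<close>
lemma word_exists:
  assumes "g \<in> carrier G"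
  shows "\<exists>ws. set ws \<subseteq> letters \<and> word_prod ws = g"
proof -
  have "g \<in> generate G S"
    using assms generators by (simp add: finite_generating_set_def)
  then show ?thesis
  proof (induction g rule: generate.induct)
    case one
    then show ?case
      by (intro exI[of _ "[]"]) simp
  next
    case (incl h)
    then have "h \<in> carrier G"
      using letters_closed by auto
    with incl show ?case
      by (intro exI[of _ "[h]"]) auto
  next
    case (inv h)
    then have "inv h \<in> letters"
      by simp
    then show ?case
      using letters_closed by (intro exI[of _ "[inv h]"]) auto
  next
    case (eng h1 h2)
    then obtain u v where "set u \<subseteq> letters" "set v \<subseteq> letters" "word_prod u = h1" "word_prod v = h2"
      by auto
    then show ?case
      using word_prod_append by (intro exI[of _ "u @ v"]) auto
  qed
qed

lemma shortest_word:
  assumes "g \<in> carrier G"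
  obtains ws where "length ws = word_length G S g" "set ws \<subseteq> letters" "word_prod ws = g"
proof -
  have "\<exists>n ws. length ws = n \<and> set ws \<subseteq> letters \<and> word_prod ws = g"
    using word_exists[OF assms] by blast
  from LeastI_ex[OF this] show ?thesis
    using that unfolding word_length_def by blast
qed

lemma word_length_le: "set ws \<subseteq> letters \<Longrightarrow> word_length G S (word_prod ws) \<le> length ws"
  unfolding word_length_def by (rule Least_le) blast

lemma word_length_mult:
  assumes "g \<in> carrier G" "h \<in> carrier G"
  shows "word_length G S (g \<otimes> h) \<le> word_length G S g + word_length G S h"
proof -
  obtain u where u: "length u = word_length G S g" "set u \<subseteq> letters" "word_prod u = g"
    using shortest_word[OF assms(1)] .
  obtain v where v: "length v = word_length G S h" "set v \<subseteq> letters" "word_prod v = h"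
    using shortest_word[OF assms(2)] .
  show ?thesis
    using word_length_le[of "u @ v"] word_prod_append[OF u(2) v(2)] u v by simp
qed

lemma word_length_inv_le:
  assumes "g \<in> carrier G"
  shows "word_length G S (inv g) \<le> word_length G S g"
proof -
  obtain u where u: "length u = word_length G S g" "set u \<subseteq> letters" "word_prod u = g"
    using shortest_word[OF assms] .
  then have "set (rev (map (m_inv G) u)) \<subseteq> letters"
    using inv_letter by auto
  from word_length_le[OF this] show ?thesis
    using word_prod_inv[OF u(2)] u by simp
qed

lemma word_length_inv: "g \<in> carrier G \<Longrightarrow> word_length G S (inv g) = word_length G S g"
  using word_length_inv_le[of g] word_length_inv_le[of "inv g"] by simp

lemma finite_word_ball: "finite {g \<in> carrier G. word_length G S g \<le> n}"
proof (rule finite_subset)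
  show "{g \<in> carrier G. word_length G S g \<le> n} \<subseteq> word_prod ` {ws. set ws \<subseteq> letters \<and> length ws \<le> n}"
  proof
    fix g assume "g \<in> {g \<in> carrier G. word_length G S g \<le> n}"
    then have g: "g \<in> carrier G" "word_length G S g \<le> n"
      by auto
    obtain u where "length u = word_length G S g" "set u \<subseteq> letters" "word_prod u = g"
      using shortest_word[OF g(1)] .
    then show "g \<in> word_prod ` {ws. set ws \<subseteq> letters \<and> length ws \<le> n}"
      using g(2) by auto
  qed
  show "finite (word_prod ` {ws. set ws \<subseteq> letters \<and> length ws \<le> n})"
    using finite_lists_length_le[OF finite_letters] by blast
qed

lemma word_dist_commute:
  "x \<in> carrier G \<Longrightarrow> y \<in> carrier G \<Longrightarrow> word_dist G S x y = word_dist G S y x"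
  unfolding word_dist_def using word_length_inv[of "inv x \<otimes> y"] by (simp add: inv_mult_group)

lemma word_dist_triangle:
  assumes "x \<in> carrier G" "y \<in> carrier G" "z \<in> carrier G"
  shows "word_dist G S x z \<le> word_dist G S x y + word_dist G S y z"
proof -
  have "inv x \<otimes> z = (inv x \<otimes> y) \<otimes> (inv y \<otimes> z)"
    using assms by (simp add: m_assoc flip: m_assoc[of y "inv y" z])
  then show ?thesis
    using word_length_mult[of "inv x \<otimes> y" "inv y \<otimes> z"] assms by (simp add: word_dist_def)
qed

lemma word_dist_right_mult:
  "x \<in> carrier G \<Longrightarrow> g \<in> carrier G \<Longrightarrow> word_dist G S x (x \<otimes> g) = word_length G S g"
  by (simp add: word_dist_def flip: m_assoc)

lemma finite_word_cball:
  assumes "x \<in> carrier G"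
  shows "finite {y \<in> carrier G. word_dist G S x y \<le> r}"
proof (rule finite_subset)
  show "{y \<in> carrier G. word_dist G S x y \<le> r} \<subseteq> (\<otimes>) x ` {g \<in> carrier G. word_length G S g \<le> nat \<lfloor>r\<rfloor>}"
  proof
    fix y assume y: "y \<in> {y \<in> carrier G. word_dist G S x y \<le> r}"
    then have "y = x \<otimes> (inv x \<otimes> y)"
      using assms by (simp flip: m_assoc)
    moreover have "word_length G S (inv x \<otimes> y) \<le> nat \<lfloor>r\<rfloor>"
      using y by (simp add: word_dist_def le_nat_floor)
    ultimately show "y \<in> (\<otimes>) x ` {g \<in> carrier G. word_length G S g \<le> nat \<lfloor>r\<rfloor>}"
      using y assms by (intro image_eqI) auto
  qed
  show "finite ((\<otimes>) x ` {g \<in> carrier G. word_length G S g \<le> nat \<lfloor>r\<rfloor>})"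
    using finite_word_ball by blast
qed

end


section \<open>Points of the Stone-Cech compactification of a discrete space as ultrafilters\<close>

locale discrete_compactification =
  fixes U :: "'a set"
begin

abbreviation discr :: "'a topology" where "discr \<equiv> discrete_topology U"
abbreviation \<beta> :: "(('a \<Rightarrow> real) \<Rightarrow> real) topology" where "\<beta> \<equiv> stone_cech discr"
abbreviation embed :: "'a \<Rightarrow> (('a \<Rightarrow> real) \<Rightarrow> real)" where "embed \<equiv> stone_cech_embed discr"

definition ind :: "('a \<Rightarrow> bool) \<Rightarrow> 'a \<Rightarrow> real" where
  "ind P = (\<lambda>x\<in>U. of_bool (P x))"

text \<open>Evaluation at the indicator function of a set is \<open>0\<close> or \<open>1\<close> and decides whether the set belongs
  to the ultrafilter of the point \<open>y\<close>. Points outside the compactification get no meaningful filter.\<close>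
definition ultrafilter :: "(('a \<Rightarrow> real) \<Rightarrow> real) \<Rightarrow> 'a filter" where
  "ultrafilter y = Abs_filter (\<lambda>P. y (ind P) = 1)"

lemma ind_unit: "ind P \<in> unit_functions discr"
  by (auto simp: unit_functions_def ind_def continuous_map_def)

lemma ind_cong: "(\<And>x. x \<in> U \<Longrightarrow> P x = Q x) \<Longrightarrow> ind P = ind Q"
  by (auto simp: ind_def)

lemma embed_ind: "x \<in> U \<Longrightarrow> embed x (ind P) = of_bool (P x)"
  using ind_unit[of P] by (simp add: stone_cech_embed_def ind_def)

lemma continuous_eval: "continuous_map \<beta> euclideanreal (\<lambda>y. y (ind P))"
proof -
  have "continuous_map (stone_cech_cube discr) (top_of_set {0..1}) (\<lambda>y. y (ind P))"
    unfolding stone_cech_cube_def by (rule continuous_map_product_projection) (rule ind_unit)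
  then show ?thesis
    unfolding stone_cech_def by (simp add: continuous_map_from_subtopology continuous_map_in_subtopology)
qed

text \<open>By density, identities between continuous functions need only be checked on the discrete space.
  This makes the sets with indicator value \<open>1\<close> a filter, and even an ultrafilter.\<close>
lemma continuous_eq_by_density:
  assumes "y \<in> topspace \<beta>" "continuous_map \<beta> euclideanreal F" "continuous_map \<beta> euclideanreal H"
    and "\<And>x. x \<in> U \<Longrightarrow> F (embed x) = H (embed x)"
  shows "F y = H y"
proof (rule forall_in_closure_of_eq[OF _ _ assms(2,3)])
  show "y \<in> \<beta> closure_of (embed ` U)"
    using assms(1) dense_stone_cech_embed[of discr] by simp
qed (use assms(4) in auto)

lemma eval_conj: "y \<in> topspace \<beta> \<Longrightarrow> y (ind (\<lambda>x. P x \<and> Q x)) = y (ind P) * y (ind Q)"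
  by (rule continuous_eq_by_density[where F = "\<lambda>y. y (ind (\<lambda>x. P x \<and> Q x))" and H = "\<lambda>y. y (ind P) * y (ind Q)"])
    (simp_all add: embed_ind continuous_eval continuous_map_real_mult)

lemma eval_not: "y \<in> topspace \<beta> \<Longrightarrow> y (ind (\<lambda>x. \<not> P x)) = 1 - y (ind P)"
  by (rule continuous_eq_by_density[where F = "\<lambda>y. y (ind (\<lambda>x. \<not> P x))" and H = "\<lambda>y. 1 - y (ind P)"])
    (simp_all add: embed_ind continuous_eval continuous_map_diff)

lemma eval_idem: "y \<in> topspace \<beta> \<Longrightarrow> y (ind P) = 0 \<or> y (ind P) = 1"
  using eval_conj[of y P P] by simp

lemma eval_True: "y \<in> topspace \<beta> \<Longrightarrow> (\<And>x. x \<in> U \<Longrightarrow> P x) \<Longrightarrow> y (ind P) = 1"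
  by (rule continuous_eq_by_density[where F = "\<lambda>y. y (ind P)" and H = "\<lambda>_. 1"]) (simp_all add: embed_ind continuous_eval)

lemma eval_mono:
  assumes "y \<in> topspace \<beta>" "y (ind P) = 1" "\<And>x. x \<in> U \<Longrightarrow> P x \<Longrightarrow> Q x"
  shows "y (ind Q) = 1"
proof -
  have "ind (\<lambda>x. P x \<and> Q x) = ind P"
    using assms(3) by (intro ind_cong) auto
  then show ?thesis
    using eval_conj[OF assms(1), of P Q] assms(2) by simp
qed

lemma eventually_ultrafilter:
  assumes "y \<in> topspace \<beta>"
  shows "eventually P (ultrafilter y) \<longleftrightarrow> y (ind P) = 1"
  unfolding ultrafilter_def
proof (rule eventually_Abs_filter)
  show "is_filter (\<lambda>P. y (ind P) = 1)"
  proof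
    show "y (ind (\<lambda>x. True)) = 1"
      using eval_True assms by simp
    show "y (ind (\<lambda>x. P x \<and> Q x)) = 1" if "y (ind P) = 1" "y (ind Q) = 1" for P Q
      using eval_conj[OF assms] that by simp
    show "y (ind Q) = 1" if "\<forall>x. P x \<longrightarrow> Q x" "y (ind P) = 1" for P Q
      using eval_mono[OF assms] that by blast
  qed
qed

lemma eventually_in_U: "y \<in> topspace \<beta> \<Longrightarrow> eventually (\<lambda>x. x \<in> U) (ultrafilter y)"
  by (simp add: eventually_ultrafilter eval_True)

lemma eventually_not_ultrafilter:
  "y \<in> topspace \<beta> \<Longrightarrow> eventually (\<lambda>x. \<not> P x) (ultrafilter y) \<longleftrightarrow> \<not> eventually P (ultrafilter y)"
  using eval_idem[of y P] by (auto simp: eventually_ultrafilter eval_not)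

lemma ultrafilter_neq_bot: "y \<in> topspace \<beta> \<Longrightarrow> ultrafilter y \<noteq> bot"
  using eventually_not_ultrafilter[of y "\<lambda>_. False"] unfolding trivial_limit_def by simp

text \<open>An ultrafilter that contains a finite union contains one of its members. In this form it yields
  limits of functions with finitely many values.\<close>
lemma eventually_ultrafilter_finite_range:
  assumes y: "y \<in> topspace \<beta>" and "finite K" "eventually (\<lambda>x. F x \<in> K) (ultrafilter y)"
  obtains k where "k \<in> K" "eventually (\<lambda>x. F x = k) (ultrafilter y)"
proof (rule ccontr)
  assume "\<not> thesis"
  then have "\<forall>k\<in>K. eventually (\<lambda>x. F x \<noteq> k) (ultrafilter y)"
    using that eventually_not_ultrafilter[OF y] by blast
  then have "eventually (\<lambda>x. \<forall>k\<in>K. F x \<noteq> k) (ultrafilter y)"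
    using \<open>finite K\<close> by (simp add: eventually_ball_finite)
  with assms(3) have "eventually (\<lambda>x. False) (ultrafilter y)"
    by eventually_elim auto
  then show False
    using ultrafilter_neq_bot[OF y] by (simp add: eventually_False)
qed

lemma openin_eventually: "openin \<beta> {y \<in> topspace \<beta>. eventually P (ultrafilter y)}"
proof -
  have "openin \<beta> {y \<in> topspace \<beta>. y (ind P) \<in> {1/2<..}}"
    by (rule openin_continuous_map_preimage[OF continuous_eval]) simp
  moreover have "{y \<in> topspace \<beta>. y (ind P) \<in> {1/2<..}} = {y \<in> topspace \<beta>. eventually P (ultrafilter y)}"
    using eval_idem[of _ P] by (force simp: eventually_ultrafilter)
  ultimately show ?thesis
    by simp
qed

lemma closedin_eventually: "closedin \<beta> {y \<in> topspace \<beta>. eventually P (ultrafilter y)}"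
proof -
  have "topspace \<beta> - {y \<in> topspace \<beta>. eventually (\<lambda>x. \<not> P x) (ultrafilter y)}
      = {y \<in> topspace \<beta>. eventually P (ultrafilter y)}"
    by (auto simp: eventually_not_ultrafilter)
  moreover have "closedin \<beta> (topspace \<beta> - {y \<in> topspace \<beta>. eventually (\<lambda>x. \<not> P x) (ultrafilter y)})"
    using openin_eventually by (intro closedin_diff closedin_topspace)
  ultimately show ?thesis
    by simp
qed

lemma embed_in_topspace: "x \<in> U \<Longrightarrow> embed x \<in> topspace \<beta>"
  using stone_cech_embed_image_subset[of discr] by (auto simp: topspace_stone_cech)

lemma eventually_ultrafilter_embed: "x \<in> U \<Longrightarrow> eventually P (ultrafilter (embed x)) \<longleftrightarrow> P x"
  by (simp add: eventually_ultrafilter embed_in_topspace embed_ind)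

text \<open>The right-hand side is closed and contains the image of \<open>A\<close>. Conversely, a point of it lies in the
  closure of the image of \<open>A\<close> or of its complement, and its ultrafilter excludes the latter.\<close>
lemma closure_of_embed:
  assumes "A \<subseteq> U"
  shows "\<beta> closure_of (embed ` A) = {y \<in> topspace \<beta>. eventually (\<lambda>x. x \<in> A) (ultrafilter y)}"
proof
  have sub: "\<beta> closure_of (embed ` C) \<subseteq> {y \<in> topspace \<beta>. eventually (\<lambda>x. x \<in> C) (ultrafilter y)}"
    if "C \<subseteq> U" for C
    using that by (intro closure_of_minimal closedin_eventually)
      (auto simp: embed_in_topspace eventually_ultrafilter_embed)
  from sub[OF assms] show "\<beta> closure_of (embed ` A) \<subseteq> {y \<in> topspace \<beta>. eventually (\<lambda>x. x \<in> A) (ultrafilter y)}" .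
  show "{y \<in> topspace \<beta>. eventually (\<lambda>x. x \<in> A) (ultrafilter y)} \<subseteq> \<beta> closure_of (embed ` A)"
  proof clarify
    fix y assume y: "y \<in> topspace \<beta>" "eventually (\<lambda>x. x \<in> A) (ultrafilter y)"
    have "embed ` U = embed ` A \<union> embed ` (U - A)"
      using assms by auto
    then have "y \<in> \<beta> closure_of (embed ` A) \<or> y \<in> \<beta> closure_of (embed ` (U - A))"
      using y(1) dense_stone_cech_embed[of discr] by (simp add: closure_of_Un flip: Un_iff)
    moreover have "\<not> eventually (\<lambda>x. x \<in> U - A) (ultrafilter y)"
    proof
      assume "eventually (\<lambda>x. x \<in> U - A) (ultrafilter y)"
      with y(2) have "eventually (\<lambda>x. False) (ultrafilter y)"
        by eventually_elim auto
      then show False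
        using ultrafilter_neq_bot[OF y(1)] by (simp add: eventually_False)
    qed
    ultimately show "y \<in> \<beta> closure_of (embed ` A)"
      using sub[of "U - A"] by auto
  qed
qed

lemma eventually_eq_iff_embed:
  assumes "y \<in> topspace \<beta>" "x \<in> U"
  shows "eventually (\<lambda>z. z = x) (ultrafilter y) \<longleftrightarrow> y = embed x"
proof -
  have "\<beta> closure_of {embed x} = {embed x}"
    using closedin_Hausdorff_singleton[OF Hausdorff_space_stone_cech embed_in_topspace[OF assms(2)]]
    by (rule closure_of_closedin)
  then show ?thesis
    using closure_of_embed[of "{x}"] assms by (simp add: set_eq_iff)
qed

lemma ultrafilter_stone_cech_map:
  assumes y: "y \<in> topspace \<beta>" and F: "F \<in> U \<rightarrow> U"
  shows "stone_cech_map discr discr F y \<in> topspace \<beta>"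
    and "eventually P (ultrafilter (stone_cech_map discr discr F y)) \<longleftrightarrow> eventually (\<lambda>x. P (F x)) (ultrafilter y)"
proof -
  have cont: "continuous_map discr discr F"
    using F by (simp add: continuous_map_def Pi_iff)
  show mem: "stone_cech_map discr discr F y \<in> topspace \<beta>"
    using continuous_map_image_subset_topspace[OF continuous_map_stone_cech_map[OF cont]] y by blast
  have "compose (topspace discr) (ind P) F = ind (\<lambda>x. P (F x))"
    using F by (auto simp: compose_def ind_def fun_eq_iff)
  then show "eventually P (ultrafilter (stone_cech_map discr discr F y)) \<longleftrightarrow> eventually (\<lambda>x. P (F x)) (ultrafilter y)"
    using y mem ind_unit by (simp add: eventually_ultrafilter stone_cech_map_def)
qed

end


section \<open>The displacement function\<close>

lemma continuous_map_prod_discrete: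
  assumes "\<And>g. g \<in> U \<Longrightarrow> continuous_map X T (\<lambda>x. F (x, g))"
  shows "continuous_map (prod_topology X (discrete_topology U)) T F"
  unfolding continuous_map_def
proof (intro conjI allI impI)
  show "F \<in> topspace (prod_topology X (discrete_topology U)) \<rightarrow> topspace T"
    using assms by (auto simp: continuous_map_def)
  fix W assume "openin T W"
  then have "openin X {x \<in> topspace X. F (x, g) \<in> W}" if "g \<in> U" for g
    using assms[OF that] by (simp add: continuous_map_def)
  then have "openin (prod_topology X (discrete_topology U)) (\<Union>g\<in>U. {x \<in> topspace X. F (x, g) \<in> W} \<times> {g})"
    by (intro openin_Union) (auto simp: openin_prod_Times_iff)
  moreover have "(\<Union>g\<in>U. {x \<in> topspace X. F (x, g) \<in> W} \<times> {g})
      = {p \<in> topspace (prod_topology X (discrete_topology U)). F p \<in> W}"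
    by auto
  ultimately show "openin (prod_topology X (discrete_topology U))
      {p \<in> topspace (prod_topology X (discrete_topology U)). F p \<in> W}"
    by simp
qed


locale embedded_box_space = word_metric G S
  for G :: "('g, 'm) monoid_scheme" (structure) and S :: "'g set" +
  fixes V :: "nat \<Rightarrow> 'v set" and E :: "nat \<Rightarrow> ('v \<times> 'v) set"
    and d :: "nat \<times> 'v \<Rightarrow> nat \<times> 'v \<Rightarrow> real" and f :: "nat \<times> 'v \<Rightarrow> 'g" and Z :: "'g set"
  assumes box: "box_space V E d"
    and large_girth: "large_girth E"
    and coarse: "coarse_embedding (box_points V) d (carrier G) (word_dist G S) f"
    and Z: "Z = f ` box_points V"
begin

interpretation discrete_compactification "carrier G" .

lemma metric: "Metric_space (box_points V) d"
  and graph: "finite_connected_graph (V n) (E n)"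
  using box unfolding box_space_def by auto

lemma box_points_iff: "u \<in> box_points V \<longleftrightarrow> snd u \<in> V (fst u)"
  by (cases u) (simp add: box_points_def)

lemma box_points_nonempty: "box_points V \<noteq> {}"
proof -
  obtain v where "v \<in> V 0"
    using graph[of 0] by (auto simp: finite_connected_graph_def)
  then have "(0, v) \<in> box_points V"
    by (simp add: box_points_def)
  then show ?thesis
    by blast
qed

lemma f_closed: "u \<in> box_points V \<Longrightarrow> f u \<in> carrier G"
  using coarse unfolding coarse_embedding_def by blast

lemma dist_same_component:
  assumes "u \<in> box_points V" "v \<in> box_points V" "fst u = fst v"
  shows "d u v = real (edge_dist (E (fst u)) (snd u) (snd v))"
proof -
  have "\<forall>n. \<forall>u\<in>V n. \<forall>v\<in>V n. d (n, u) (n, v) = real (edge_dist (E n) u v)"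
    using box unfolding box_space_def by blast
  then show ?thesis
    using assms by (metis box_points_iff prod.collapse)
qed

lemma coarse_upper:
  obtains C where "\<And>u v. u \<in> box_points V \<Longrightarrow> v \<in> box_points V \<Longrightarrow> d u v \<le> r \<Longrightarrow>
    word_dist G S (f u) (f v) \<le> C"
proof -
  obtain rho where rho: "mono_on {0..} rho"
    "\<And>u v. u \<in> box_points V \<Longrightarrow> v \<in> box_points V \<Longrightarrow> word_dist G S (f u) (f v) \<le> rho (d u v)"
    using coarse unfolding coarse_embedding_def by blast
  have nonneg: "0 \<le> d u v" for u v
    using Metric_space.nonneg[OF metric] .
  have "word_dist G S (f u) (f v) \<le> rho r"
    if uv: "u \<in> box_points V" "v \<in> box_points V" "d u v \<le> r" for u v
  proof -
    have "rho (d u v) \<le> rho r"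
      using rho(1) nonneg[of u v] uv(3) by (auto simp: mono_on_def)
    then show ?thesis
      using rho(2)[OF uv(1,2)] by linarith
  qed
  then show ?thesis
    using that by blast
qed

lemma coarse_lower:
  obtains C where "\<And>u v. u \<in> box_points V \<Longrightarrow> v \<in> box_points V \<Longrightarrow>
    word_dist G S (f u) (f v) \<le> r \<Longrightarrow> d u v \<le> C"
proof -
  obtain rho :: "real \<Rightarrow> real" where rho: "filterlim rho at_top at_top"
    "\<And>u v. u \<in> box_points V \<Longrightarrow> v \<in> box_points V \<Longrightarrow> rho (d u v) \<le> word_dist G S (f u) (f v)"
    using coarse unfolding coarse_embedding_def by blast
  have "eventually (\<lambda>t. r < rho t) at_top"
    using rho(1) by (simp add: filterlim_at_top_dense)
  then obtain C where C: "\<And>t. C \<le> t \<Longrightarrow> r < rho t"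
    by (auto simp: eventually_at_top_linorder)
  have "d u v \<le> C"
    if "u \<in> box_points V" "v \<in> box_points V" "word_dist G S (f u) (f v) \<le> r" for u v
    using C[of "d u v"] rho(2)[OF that(1,2)] that(3) by linarith
  then show ?thesis
    using that by blast
qed

lemma components_separated:
  obtains N where "\<And>u v. u \<in> box_points V \<Longrightarrow> v \<in> box_points V \<Longrightarrow> N \<le> fst u \<Longrightarrow> d u v \<le> r \<Longrightarrow>
    fst v = fst u"
proof -
  let ?A = "\<lambda>n. box_component V n \<times> (\<Union>m\<in>-{n}. box_component V m)"
  have "filterlim (\<lambda>n. set_dist d (box_component V n) (\<Union>m\<in>-{n}. box_component V m)) at_top sequentially"
    using box unfolding box_space_def by blast
  then have "eventually (\<lambda>n. r < set_dist d (box_component V n) (\<Union>m\<in>-{n}. box_component V m)) sequentially"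
    by (simp add: filterlim_at_top_dense)
  then obtain N where N: "\<And>n. N \<le> n \<Longrightarrow> r < (INF (x, y) \<in> ?A n. d x y)"
    by (auto simp: eventually_sequentially set_dist_def)
  have "fst v = fst u"
    if uv: "u \<in> box_points V" "v \<in> box_points V" "N \<le> fst u" "d u v \<le> r" for u v
  proof (rule ccontr)
    assume "fst v \<noteq> fst u"
    then have mem: "(u, v) \<in> ?A (fst u)"
      using uv(1,2) by (cases u; cases v) (auto simp: box_component_def box_points_def)
    have "bdd_below ((\<lambda>(x, y). d x y) ` ?A (fst u))"
      using Metric_space.nonneg[OF metric] by (intro bdd_belowI[of _ 0]) auto
    from cINF_lower[OF this mem] N[OF uv(3)] uv(4) show False
      by simp
  qed
  then show ?thesis
    using that by blast
qed

definition near :: "'g \<Rightarrow> nat \<times> 'v" where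
  "near x = (ARG_MIN (\<lambda>v. word_length G S (inv x \<otimes> f v)) v. v \<in> box_points V)"

lemma near: "near x \<in> box_points V"
  and near_le: "v \<in> box_points V \<Longrightarrow> word_dist G S x (f (near x)) \<le> word_dist G S x (f v)"
proof -
  obtain u where u: "u \<in> box_points V"
    using box_points_nonempty by blast
  note * = arg_min_nat_lemma[of "\<lambda>v. v \<in> box_points V", OF u, of "\<lambda>v. word_length G S (inv x \<otimes> f v)"]
  show "near x \<in> box_points V"
    using * unfolding near_def by blast
  show "word_dist G S x (f (near x)) \<le> word_dist G S x (f v)" if "v \<in> box_points V"
    using * that unfolding near_def word_dist_def of_nat_le_iff by blast
qed

lemma nbhd_carrier: "x \<in> nbhd G S R Z \<Longrightarrow> x \<in> carrier G"
  by (simp add: nbhd_def)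

lemma near_nbhd: "x \<in> nbhd G S R Z \<Longrightarrow> word_dist G S x (f (near x)) \<le> R"
proof -
  assume "x \<in> nbhd G S R Z"
  then have "\<exists>v\<in>box_points V. word_dist G S x (f v) \<le> R"
    by (simp add: nbhd_def Z)
  then obtain v where "v \<in> box_points V" "word_dist G S x (f v) \<le> R" ..
  then show ?thesis
    using near_le[of v x] by linarith
qed

lemma nbhd_mono: "R \<le> R' \<Longrightarrow> x \<in> nbhd G S R Z \<Longrightarrow> x \<in> nbhd G S R' Z"
proof -
  assume le: "R \<le> R'" and "x \<in> nbhd G S R Z"
  then obtain z where "x \<in> carrier G" "z \<in> Z" "word_dist G S x z \<le> R"
    by (auto simp: nbhd_def)
  moreover from this(3) le have "word_dist G S x z \<le> R'"
    by (rule order.trans)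
  ultimately show ?thesis
    by (auto simp: nbhd_def)
qed

lemma nbhd_right_mult:
  assumes "x \<in> nbhd G S R Z" "g \<in> carrier G"
  shows "x \<otimes> g \<in> nbhd G S (R + real (word_length G S g)) Z"
proof -
  obtain z where z: "z \<in> Z" "word_dist G S x z \<le> R" and x: "x \<in> carrier G"
    using assms(1) by (auto simp: nbhd_def)
  have "z \<in> carrier G"
    using z(1) f_closed by (auto simp: Z)
  then have "word_dist G S (x \<otimes> g) z \<le> word_length G S g + R"
    using word_dist_triangle[of "x \<otimes> g" x z] word_dist_commute[of "x \<otimes> g" x]
      word_dist_right_mult[of x g] x z(2) assms(2) by simp
  then show ?thesis
    using z(1) x assms(2) by (auto simp: nbhd_def add.commute)
qed

abbreviation Y :: "(('g \<Rightarrow> real) \<Rightarrow> real) set" where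
  "Y \<equiv> boundary_piece G S Z"

lemma beta_eq: "beta G = \<beta>"
  by (simp add: beta_def)

text \<open>In terms of ultrafilters: \<open>x\<close> stays close to \<open>Z\<close> but avoids every group element as it tends to
  \<open>y\<close>.\<close>
lemma in_Y_iff:
  "y \<in> Y \<longleftrightarrow> y \<in> topspace \<beta> \<and> (\<exists>R::nat. eventually (\<lambda>x. x \<in> nbhd G S (real R) Z) (ultrafilter y))
     \<and> (\<forall>g\<in>carrier G. eventually (\<lambda>x. x \<noteq> g) (ultrafilter y))"
proof -
  have "nbhd G S R Z \<subseteq> carrier G" for R
    using nbhd_carrier by blast
  then show ?thesis
    by (auto simp: boundary_piece_def beta_boundary_def beta_eq beta_embed_def closure_of_embed
        eventually_not_ultrafilter eventually_eq_iff_embed image_iff)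
qed

lemma Y_subset: "Y \<subseteq> topspace \<beta>"
  by (auto simp: in_Y_iff)

lemma eventually_carrier: "y \<in> Y \<Longrightarrow> eventually (\<lambda>x. x \<in> carrier G) (ultrafilter y)"
  using eventually_in_U Y_subset by blast

lemma eventually_not_in_finite:
  assumes "y \<in> Y" "finite F"
  shows "eventually (\<lambda>x. x \<notin> F) (ultrafilter y)"
proof -
  have "\<forall>g\<in>F \<inter> carrier G. eventually (\<lambda>x. x \<noteq> g) (ultrafilter y)"
    using assms(1) by (simp add: in_Y_iff)
  then have "eventually (\<lambda>x. \<forall>g\<in>F \<inter> carrier G. x \<noteq> g) (ultrafilter y)"
    using assms(2) by (intro eventually_ball_finite) auto
  with eventually_carrier[OF assms(1)] show ?thesis
    by eventually_elim auto
qed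

text \<open>Group elements close to \<open>Z\<close> with nearest point in a given finite set of components lie in finitely
  many balls of the word metric. These are finite, and a boundary point avoids finite sets.\<close>
lemma eventually_component_ge:
  assumes y: "y \<in> Y"
  shows "eventually (\<lambda>x. N \<le> fst (near x)) (ultrafilter y)"
proof -
  obtain R :: nat where R: "eventually (\<lambda>x. x \<in> nbhd G S (real R) Z) (ultrafilter y)"
    using y by (auto simp: in_Y_iff)
  define F where "F = (\<Union>u\<in>Sigma {..<N} V. {x \<in> carrier G. word_dist G S (f u) x \<le> real R})"
  have "finite (V n)" for n
    using graph[of n] by (simp add: finite_connected_graph_def)
  moreover have "Sigma {..<N} V \<subseteq> box_points V"
    by (auto simp: box_points_def)
  ultimately have "finite F"
    unfolding F_def using finite_word_cball f_closed by blast
  from eventually_not_in_finite[OF y this] R show ?thesis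
  proof eventually_elim
    case (elim x)
    note x = nbhd_carrier[OF elim(2)]
    show ?case
    proof (rule ccontr)
      assume "\<not> N \<le> fst (near x)"
      then have "near x \<in> Sigma {..<N} V"
        using near[of x] by (cases "near x") (auto simp: box_points_def)
      moreover have "word_dist G S (f (near x)) x \<le> real R"
        using near_nbhd[OF elim(2)] word_dist_commute[OF x f_closed[OF near]] by simp
      ultimately have "x \<in> F"
        unfolding F_def using x by (intro UN_I[of "near x"]) simp_all
      with elim(1) show False ..
    qed
  qed
qed

abbreviation act :: "(('g \<Rightarrow> real) \<Rightarrow> real) \<Rightarrow> 'g \<Rightarrow> (('g \<Rightarrow> real) \<Rightarrow> real)" where
  "act \<equiv> beta_right_mult G"

lemma act_in_topspace: "y \<in> topspace \<beta> \<Longrightarrow> g \<in> carrier G \<Longrightarrow> act y g \<in> topspace \<beta>"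
  and eventually_act: "y \<in> topspace \<beta> \<Longrightarrow> g \<in> carrier G \<Longrightarrow>
    eventually P (ultrafilter (act y g)) \<longleftrightarrow> eventually (\<lambda>x. P (x \<otimes> g)) (ultrafilter y)"
  unfolding beta_right_mult_def by (intro ultrafilter_stone_cech_map; simp)+

lemma act_in_Y:
  assumes y: "y \<in> Y" and g: "g \<in> carrier G"
  shows "act y g \<in> Y"
  unfolding in_Y_iff
proof (intro conjI ballI)
  have y_beta: "y \<in> topspace \<beta>"
    using y Y_subset by blast
  then show "act y g \<in> topspace \<beta>"
    using g by (rule act_in_topspace)
  obtain R :: nat where "eventually (\<lambda>x. x \<in> nbhd G S (real R) Z) (ultrafilter y)"
    using y by (auto simp: in_Y_iff)
  then have "eventually (\<lambda>x. x \<otimes> g \<in> nbhd G S (real (R + word_length G S g)) Z) (ultrafilter y)"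
    by eventually_elim (use nbhd_right_mult[OF _ g] in simp)
  then show "\<exists>R::nat. eventually (\<lambda>x. x \<in> nbhd G S (real R) Z) (ultrafilter (act y g))"
    using eventually_act[OF y_beta g] by blast
  fix k assume k: "k \<in> carrier G"
  have "eventually (\<lambda>x. x \<notin> {k \<otimes> inv g}) (ultrafilter y)"
    using y by (rule eventually_not_in_finite) simp
  with eventually_carrier[OF y] have "eventually (\<lambda>x. x \<otimes> g \<noteq> k) (ultrafilter y)"
    by eventually_elim (use g k in \<open>auto simp: m_assoc\<close>)
  then show "eventually (\<lambda>x. x \<noteq> k) (ultrafilter (act y g))"
    by (simp add: eventually_act[OF y_beta g])
qed

lemma act_one:
  assumes "y \<in> topspace \<beta>"
  shows "act y \<one> = y"
proof -
  have "compose (carrier G) \<phi> (\<lambda>x. x \<otimes> \<one>) = \<phi>" if "\<phi> \<in> unit_functions discr" for \<phi>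
    using that by (auto simp: compose_def unit_functions_def extensional_def fun_eq_iff)
  moreover have "y \<in> extensional (unit_functions discr)"
    using assms by (auto simp: stone_cech_def topspace_stone_cech_cube PiE_def)
  ultimately show ?thesis
    by (intro ext) (simp add: beta_right_mult_def stone_cech_map_def extensional_def)
qed

lemma act_act:
  assumes "g \<in> carrier G" "h \<in> carrier G"
  shows "act (act y g) h = act y (g \<otimes> h)"
proof
  fix \<phi>
  have "continuous_map discr discr (\<lambda>x. x \<otimes> h)"
    using assms by (simp add: continuous_map_def Pi_iff)
  then have "compose (carrier G) \<phi> (\<lambda>x. x \<otimes> h) \<in> unit_functions discr" if "\<phi> \<in> unit_functions discr"
    using compose_in_unit_functions[of discr discr] that by simp
  moreover have "compose (carrier G) (compose (carrier G) \<phi> (\<lambda>x. x \<otimes> h)) (\<lambda>x. x \<otimes> g)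
      = compose (carrier G) \<phi> (\<lambda>x. x \<otimes> (g \<otimes> h))"
    using assms by (auto simp: compose_def m_assoc)
  ultimately show "act (act y g) h \<phi> = act y (g \<otimes> h) \<phi>"
    by (simp add: beta_right_mult_def stone_cech_map_def)
qed

lemma continuous_act: "g \<in> carrier G \<Longrightarrow> continuous_map (subtopology \<beta> Y) (subtopology \<beta> Y) (\<lambda>y. act y g)"
proof -
  assume g: "g \<in> carrier G"
  have "continuous_map discr discr (\<lambda>x. x \<otimes> g)"
    using g by (simp add: continuous_map_def Pi_iff)
  from continuous_map_stone_cech_map[OF this] have "continuous_map \<beta> \<beta> (\<lambda>y. act y g)"
    by (simp add: beta_right_mult_def)
  then show ?thesis
    using act_in_Y[OF _ g] by (auto simp: continuous_map_in_subtopology continuous_map_from_subtopology)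
qed

text \<open>The limit of \<open>d (near x) (near (x \<otimes> g))\<close> as \<open>x\<close> tends to \<open>y\<close>. The distance is
  constant along the ultrafilter of a boundary point, so the limit is the value that it takes there.\<close>
definition displacement :: "(('g \<Rightarrow> real) \<Rightarrow> real) \<times> 'g \<Rightarrow> real" where
  "displacement = (\<lambda>(y, g). THE r. eventually (\<lambda>x. d (near x) (near (x \<otimes> g)) = r) (ultrafilter y))"

lemma displacementI:
  assumes "y \<in> Y" "eventually (\<lambda>x. d (near x) (near (x \<otimes> g)) = r) (ultrafilter y)"
  shows "displacement (y, g) = r"
  unfolding displacement_def prod.case
proof (rule the_equality)
  show "eventually (\<lambda>x. d (near x) (near (x \<otimes> g)) = r) (ultrafilter y)"
    by (fact assms(2))
  fix s assume "eventually (\<lambda>x. d (near x) (near (x \<otimes> g)) = s) (ultrafilter y)"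
  with assms(2) have "eventually (\<lambda>x. s = r) (ultrafilter y)"
    by eventually_elim simp
  then show "s = r"
    using ultrafilter_neq_bot Y_subset assms(1) by auto
qed

text \<open>If \<open>x\<close> is within \<open>R\<close> of \<open>Z\<close>, then \<open>x g\<close> is within \<open>R\<close> plus the length of \<open>g\<close>, so the images of
  the two nearest points have bounded distance in the group; the embedding is coarse, so the points
  themselves have bounded distance.\<close>
lemma eventually_bounded_displacement:
  assumes y: "y \<in> Y" and g: "g \<in> carrier G"
  obtains C where "eventually (\<lambda>x. d (near x) (near (x \<otimes> g)) \<le> C) (ultrafilter y)"
proof -
  obtain R :: nat where R: "eventually (\<lambda>x. x \<in> nbhd G S (real R) Z) (ultrafilter y)"
    using y by (auto simp: in_Y_iff)
  let ?l = "real (word_length G S g)"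
  obtain C where C: "\<And>u v. u \<in> box_points V \<Longrightarrow> v \<in> box_points V \<Longrightarrow>
      word_dist G S (f u) (f v) \<le> 2 * R + 2 * ?l \<Longrightarrow> d u v \<le> C"
    using coarse_lower by blast
  from R have "eventually (\<lambda>x. d (near x) (near (x \<otimes> g)) \<le> C) (ultrafilter y)"
  proof eventually_elim
    case (elim x)
    note x = nbhd_carrier[OF elim]
    note fx = f_closed[OF near[of x]] and fxg = f_closed[OF near[of "x \<otimes> g"]]
    have "word_dist G S (f (near x)) (f (near (x \<otimes> g)))
        \<le> word_dist G S (f (near x)) x + (word_dist G S x (x \<otimes> g) + word_dist G S (x \<otimes> g) (f (near (x \<otimes> g))))"
      using word_dist_triangle[OF fx x fxg] word_dist_triangle[OF x _ fxg, of "x \<otimes> g"] x g by simp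
    also have "\<dots> \<le> R + (?l + (R + ?l))"
      using near_nbhd[OF elim] near_nbhd[OF nbhd_right_mult[OF elim g]] word_dist_commute[OF x fx]
        word_dist_right_mult[OF x g] by simp
    finally show ?case
      using C[OF near near] by simp
  qed
  then show ?thesis
    by (rule that)
qed

lemma eventually_same_component:
  assumes y: "y \<in> Y" and g: "g \<in> carrier G"
  shows "eventually (\<lambda>x. fst (near (x \<otimes> g)) = fst (near x)) (ultrafilter y)"
proof -
  obtain C where C: "eventually (\<lambda>x. d (near x) (near (x \<otimes> g)) \<le> C) (ultrafilter y)"
    using eventually_bounded_displacement[OF assms] .
  obtain N where N: "\<And>u v. u \<in> box_points V \<Longrightarrow> v \<in> box_points V \<Longrightarrow> N \<le> fst u \<Longrightarrow> d u v \<le> C \<Longrightarrow>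
      fst v = fst u"
    using components_separated by blast
  from C eventually_component_ge[OF y, of N] show ?thesis
    by eventually_elim (use N near in blast)
qed

text \<open>A bounded distance within one component has finitely many possible values, so it is constant along
  an ultrafilter.\<close>
lemma eventually_displacement_nat:
  assumes y: "y \<in> Y" and g: "g \<in> carrier G"
  obtains k :: nat where "eventually (\<lambda>x. d (near x) (near (x \<otimes> g)) = real k) (ultrafilter y)"
proof -
  obtain C where C: "eventually (\<lambda>x. d (near x) (near (x \<otimes> g)) \<le> C) (ultrafilter y)"
    using eventually_bounded_displacement[OF assms] .
  from C eventually_same_component[OF assms]
  have "eventually (\<lambda>x. d (near x) (near (x \<otimes> g)) \<in> real ` {..nat \<lfloor>C\<rfloor>}) (ultrafilter y)"
    by eventually_elim (auto simp: dist_same_component near le_nat_floor)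
  then obtain r where "r \<in> real ` {..nat \<lfloor>C\<rfloor>}" "eventually (\<lambda>x. d (near x) (near (x \<otimes> g)) = r) (ultrafilter y)"
    by (rule eventually_ultrafilter_finite_range[OF subsetD[OF Y_subset y], rotated]) simp_all
  then show ?thesis
    using that by auto
qed

lemma eventually_displacement:
  assumes "y \<in> Y" "g \<in> carrier G"
  shows "eventually (\<lambda>x. d (near x) (near (x \<otimes> g)) = displacement (y, g)) (ultrafilter y)"
proof -
  obtain k :: nat where k: "eventually (\<lambda>x. d (near x) (near (x \<otimes> g)) = real k) (ultrafilter y)"
    using eventually_displacement_nat[OF assms] .
  then show ?thesis
    using displacementI[OF assms(1) k] by simp
qed

lemma displacement_eq_iff:
  assumes "y \<in> Y" "g \<in> carrier G"
  shows "displacement (y, g) = r \<longleftrightarrow> eventually (\<lambda>x. d (near x) (near (x \<otimes> g)) = r) (ultrafilter y)"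
proof
  assume "displacement (y, g) = r"
  then show "eventually (\<lambda>x. d (near x) (near (x \<otimes> g)) = r) (ultrafilter y)"
    using eventually_displacement[OF assms] by (rule subst)
qed (rule displacementI[OF assms(1)])

lemma displacement_in_Nats: "y \<in> Y \<Longrightarrow> g \<in> carrier G \<Longrightarrow> displacement (y, g) \<in> \<nat>"
proof -
  assume y: "y \<in> Y" and g: "g \<in> carrier G"
  obtain k :: nat where k: "eventually (\<lambda>x. d (near x) (near (x \<otimes> g)) = real k) (ultrafilter y)"
    using eventually_displacement_nat[OF y g] .
  show ?thesis
    using displacementI[OF y k] by simp
qed

text \<open>The value at \<open>(y (g i), (g i)\<^sup>-\<^sup>1 (g j))\<close> is the limit of the distances of \<open>near (x \<otimes> g i)\<close> and
  \<open>near (x \<otimes> g j)\<close>. A single \<open>x\<close> close to \<open>y\<close> realises these finitely many limits exactly and has all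
  points in one component of large girth.\<close>
lemma displacement_conditionally_negative:
  fixes n :: nat and t :: "nat \<Rightarrow> real"
  assumes y: "y \<in> Y" and g: "\<And>i. i < n \<Longrightarrow> g i \<in> carrier G" and t: "(\<Sum>i<n. t i) = 0"
  shows "(\<Sum>i<n. \<Sum>j<n. t i * t j * displacement (act y (g i), inv (g i) \<otimes> g j)) \<le> 0"
proof -
  have y_beta: "y \<in> topspace \<beta>"
    using y Y_subset by blast
  let ?h = "\<lambda>i j. displacement (act y (g i), inv (g i) \<otimes> g j)"
  have pair: "eventually (\<lambda>x. d (near (x \<otimes> g i)) (near (x \<otimes> g j)) = ?h i j) (ultrafilter y)"
    if "i < n" "j < n" for i j
  proof -
    note gi = g[OF that(1)] and gj = g[OF that(2)]
    have "eventually (\<lambda>x. d (near (x \<otimes> g i)) (near (x \<otimes> g i \<otimes> (inv (g i) \<otimes> g j))) = ?h i j) (ultrafilter y)"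
      using eventually_displacement[OF act_in_Y[OF y gi], of "inv (g i) \<otimes> g j"] gi gj
      by (simp add: eventually_act[OF y_beta gi])
    with eventually_carrier[OF y] show ?thesis
    proof eventually_elim
      case (elim x)
      then have "x \<otimes> g i \<otimes> (inv (g i) \<otimes> g j) = x \<otimes> g j"
        using gi gj by (simp add: m_assoc flip: m_assoc[of "g i" "inv (g i)"])
      then show ?case
        using elim by simp
    qed
  qed
  then have pairs: "eventually (\<lambda>x. \<forall>i\<in>{..<n}. \<forall>j\<in>{..<n}. d (near (x \<otimes> g i)) (near (x \<otimes> g j)) = ?h i j) (ultrafilter y)"
    by (intro eventually_ball_finite ballI) auto
  have comps: "eventually (\<lambda>x. \<forall>i\<in>{..<n}. fst (near (x \<otimes> g i)) = fst (near x)) (ultrafilter y)"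
    using eventually_same_component[OF y] g by (intro eventually_ball_finite ballI) auto
  \<comment> \<open>\<open>M\<close> bounds all distances that occur; it fixes the girth needed before \<open>x\<close> is chosen.\<close>
  define M where "M = nat \<lceil>Max ((\<lambda>(i, j). ?h i j) ` ({..<n} \<times> {..<n}))\<rceil>"
  have M: "?h i j \<le> real M" if "i < n" "j < n" for i j
  proof -
    have "?h i j \<le> Max ((\<lambda>(i, j). ?h i j) ` ({..<n} \<times> {..<n}))"
      using that by (intro Max_ge) auto
    then show ?thesis
      unfolding M_def by linarith
  qed
  have "eventually (\<lambda>n. enat (4 * M + 1) < girth (E n)) sequentially"
    using large_girth unfolding large_girth_def by (rule order_tendstoD) simp
  then obtain N where N: "\<And>n. N \<le> n \<Longrightarrow> enat (4 * M + 1) < girth (E n)"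
    by (auto simp: eventually_sequentially)
  from pairs comps eventually_component_ge[OF y, of N]
  have "eventually (\<lambda>x. (\<Sum>i<n. \<Sum>j<n. t i * t j * ?h i j) \<le> 0) (ultrafilter y)"
  proof eventually_elim
    case (elim x)
    let ?c = "fst (near x)" and ?v = "\<lambda>i. snd (near (x \<otimes> g i))"
    have dist: "?h i j = real (edge_dist (E ?c) (?v i) (?v j))" if "i < n" "j < n" for i j
      using elim that dist_same_component[OF near near, of "x \<otimes> g i" "x \<otimes> g j"] by simp
    have "?v i \<in> V ?c" if "i < n" for i
      using elim that near[of "x \<otimes> g i"] by (simp add: box_points_iff)
    moreover have "edge_dist (E ?c) (?v i) (?v j) \<le> M" if "i < n" "j < n" for i j
      using M[OF that] dist[OF that] by simp
    moreover have "enat (4 * M + 1) < girth (E ?c)"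
      using N elim(3) by blast
    ultimately have "(\<Sum>i<n. \<Sum>j<n. t i * t j * real (edge_dist (E ?c) (?v i) (?v j))) \<le> 0"
      using t by (intro edge_dist_conditionally_negative[OF graph]) auto
    then show ?case
      by (simp add: dist)
  qed
  then show ?thesis
    using ultrafilter_neq_bot[OF y_beta] by auto
qed

lemma displacement_conditionally_negative_type: "conditionally_negative_type G Y act displacement"
  unfolding conditionally_negative_type_def
proof (intro conjI ballI allI impI)
  fix y assume y: "y \<in> Y"
  from eventually_carrier[OF y]
  have "eventually (\<lambda>x. d (near x) (near (x \<otimes> \<one>)) = 0) (ultrafilter y)"
    by eventually_elim (simp add: Metric_space.mdist_zero[OF metric near])
  then show "displacement (y, \<one>) = 0"
    by (rule displacementI[OF y])
next
  fix y g assume y: "y \<in> Y" and g: "g \<in> carrier G"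
  have y_beta: "y \<in> topspace \<beta>"
    using y Y_subset by blast
  from eventually_displacement[OF y g] eventually_carrier[OF y]
  have "eventually (\<lambda>x. d (near (x \<otimes> g)) (near (x \<otimes> g \<otimes> inv g)) = displacement (y, g)) (ultrafilter y)"
    by eventually_elim (use g Metric_space.commute[OF metric] in \<open>simp add: m_assoc\<close>)
  then have "eventually (\<lambda>x. d (near x) (near (x \<otimes> inv g)) = displacement (y, g)) (ultrafilter (act y g))"
    by (simp add: eventually_act[OF y_beta g])
  then show "displacement (y, g) = displacement (act y g, inv g)"
    by (rule displacementI[OF act_in_Y[OF y g], symmetric])
next
  fix y g and n :: nat and t :: "nat \<Rightarrow> real"
  assume "y \<in> Y" "(\<forall>i<n. g i \<in> carrier G) \<and> (\<Sum>i<n. t i) = 0"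
  then show "(\<Sum>i<n. \<Sum>j<n. t i * t j * displacement (act y (g i), inv (g i) \<otimes> g j)) \<le> 0"
    by (intro displacement_conditionally_negative) auto
qed

section \<open>Topology of the action\<close>

abbreviation TY :: "(('g \<Rightarrow> real) \<Rightarrow> real) topology" where
  "TY \<equiv> subtopology \<beta> Y"

lemma topspace_TY: "topspace TY = Y"
  using Y_subset by auto

lemma openin_TY: "openin TY {y \<in> Y. eventually P (ultrafilter y)}"
proof -
  have "{y \<in> Y. eventually P (ultrafilter y)} = {y \<in> topspace \<beta>. eventually P (ultrafilter y)} \<inter> Y"
    using Y_subset by auto
  then show ?thesis
    using openin_eventually by (auto simp: openin_subtopology)
qed

lemma Hausdorff_TY: "Hausdorff_space TY"
  by (simp add: Hausdorff_space_stone_cech Hausdorff_space_subtopology)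

text \<open>Membership in the closures of the neighbourhoods of \<open>Z\<close> is an open condition because these closures
  are open; avoiding the group elements is a closed one. So \<open>Y\<close> is locally closed in a compact space.\<close>
lemma locally_compact_TY: "locally_compact_space TY"
proof -
  define W where "W = (\<Union>R::nat. {y \<in> topspace \<beta>. eventually (\<lambda>x. x \<in> nbhd G S (real R) Z) (ultrafilter y)})"
  define N where "N = (\<Union>g\<in>carrier G. {y \<in> topspace \<beta>. eventually (\<lambda>x. x = g) (ultrafilter y)})"
  have open_W: "openin \<beta> W" and open_N: "openin \<beta> N"
    unfolding W_def N_def by (blast intro: openin_eventually)+
  have Y: "Y = W \<inter> (topspace \<beta> - N)"
    by (auto simp: W_def N_def in_Y_iff eventually_not_ultrafilter)
  have "locally_compact_space (subtopology \<beta> W)"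
    using open_W compact_space_stone_cech Hausdorff_space_stone_cech
    by (intro locally_compact_space_open_subset compact_imp_locally_compact_space) auto
  moreover have "closedin (subtopology \<beta> W) Y"
    using open_N Y by (auto simp: closedin_subtopology)
  ultimately have "locally_compact_space (subtopology (subtopology \<beta> W) Y)"
    by (rule locally_compact_space_closed_subset)
  moreover have "W \<inter> Y = Y"
    using Y by blast
  ultimately show ?thesis
    by (simp add: subtopology_subtopology)
qed

lemma continuous_displacement_slice:
  assumes g: "g \<in> carrier G"
  shows "continuous_map TY euclideanreal (\<lambda>y. displacement (y, g))"
  unfolding continuous_map_def topspace_TY
proof (intro conjI allI impI)
  fix W :: "real set"
  have "{y \<in> Y. displacement (y, g) \<in> W} = (\<Union>r\<in>W. {y \<in> Y. displacement (y, g) = r})"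
    by auto
  also have "\<dots> = (\<Union>r\<in>W. {y \<in> Y. eventually (\<lambda>x. d (near x) (near (x \<otimes> g)) = r) (ultrafilter y)})"
    using displacement_eq_iff[OF _ g] by (intro SUP_cong Collect_cong) auto
  also have "openin TY \<dots>"
    by (blast intro: openin_TY)
  finally show "openin TY {y \<in> Y. displacement (y, g) \<in> W}" .
qed auto

lemma continuous_displacement: "continuous_map (prod_topology TY discr) euclideanreal displacement"
  by (rule continuous_map_prod_discrete) (rule continuous_displacement_slice)

lemma continuous_right_action_TY: "continuous_right_action G discr TY act"
  unfolding continuous_right_action_def
proof (intro conjI ballI)
  show "locally_compact_group G discr"
    using group_axioms
    by (auto simp: locally_compact_group_def locally_compact_space_discrete_topology
        Hausdorff_space_discrete_topology Pi_iff continuous_map_def simp flip: prod_topology_discrete_topology)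
  show "continuous_map (prod_topology TY discr) TY (\<lambda>(y, g). act y g)"
    by (rule continuous_map_prod_discrete) (simp add: continuous_act)
qed (use topspace_TY Y_subset in \<open>auto simp: locally_compact_TY Hausdorff_TY act_one act_act\<close>)

text \<open>The closures of the neighbourhoods of \<open>Z\<close> are open and increase with the radius, so one of them
  covers a compact set.\<close>
lemma compactin_TY_uniform:
  assumes K: "compactin TY K"
  shows "\<exists>R::nat. \<forall>y\<in>K. eventually (\<lambda>x. x \<in> nbhd G S (real R) Z) (ultrafilter y)"
proof -
  define W where "W R = {y \<in> Y. eventually (\<lambda>x. x \<in> nbhd G S (real R) Z) (ultrafilter y)}" for R :: nat
  have KY: "K \<subseteq> Y"
    using compactin_subset_topspace[OF K] topspace_TY by simp
  then have "K \<subseteq> \<Union>(range W)"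
    by (auto simp: W_def in_Y_iff)
  moreover have "openin TY T" if "T \<in> range W" for T
    using that openin_TY by (auto simp: W_def)
  ultimately obtain \<F> where F: "finite \<F>" "\<F> \<subseteq> range W" "K \<subseteq> \<Union>\<F>"
    using compactinD[OF K] by metis
  then obtain I where I: "finite I" "\<F> = W ` I"
    by (metis finite_subset_image)
  have "eventually (\<lambda>x. x \<in> nbhd G S (real (Max I)) Z) (ultrafilter y)" if "y \<in> K" for y
  proof -
    have "y \<in> \<Union>(W ` I)"
      using that F(3) I(2) by blast
    then obtain i where i: "i \<in> I" "eventually (\<lambda>x. x \<in> nbhd G S (real i) Z) (ultrafilter y)"
      unfolding W_def by blast
    have "real i \<le> real (Max I)"
      using I(1) i(1) by simp
    from i(2) show ?thesis
      by eventually_elim (rule nbhd_mono[OF \<open>real i \<le> real (Max I)\<close>])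
  qed
  then show ?thesis
    by blast
qed

text \<open>Near \<open>y\<close>, both \<open>x\<close> and \<open>x g\<close> are within the radius \<open>R\<close> of \<open>Z\<close>, and their nearest points are at
  distance \<open>r\<close> in the box space. So the length of \<open>g\<close>, the distance of \<open>x\<close> and \<open>x g\<close>, is bounded in
  terms of \<open>R\<close> and \<open>r\<close>.\<close>
lemma finitely_many_return_elements:
  assumes K: "compactin TY K"
  shows "finite {g \<in> carrier G. \<exists>y\<in>K. act y g \<in> K \<and> displacement (y, g) = r}"
proof -
  have KY: "K \<subseteq> Y"
    using compactin_subset_topspace[OF K] topspace_TY by simp
  obtain R :: nat where R: "\<forall>y\<in>K. eventually (\<lambda>x. x \<in> nbhd G S (real R) Z) (ultrafilter y)"
    using compactin_TY_uniform[OF K] ..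
  obtain C where C: "\<And>u v. u \<in> box_points V \<Longrightarrow> v \<in> box_points V \<Longrightarrow> d u v \<le> r \<Longrightarrow>
      word_dist G S (f u) (f v) \<le> C"
    using coarse_upper by blast
  have "word_length G S g \<le> nat \<lfloor>2 * real R + C\<rfloor>"
    if g: "g \<in> carrier G" and y: "y \<in> K" "act y g \<in> K" and h: "displacement (y, g) = r" for g y
  proof -
    have "y \<in> Y" and y_beta: "y \<in> topspace \<beta>"
      using y KY Y_subset by auto
    have "eventually (\<lambda>x. x \<otimes> g \<in> nbhd G S (real R) Z) (ultrafilter y)"
      using bspec[OF R y(2)] eventually_act[OF y_beta g] by simp
    with bspec[OF R y(1)] eventually_displacement[OF \<open>y \<in> Y\<close> g]
    have "eventually (\<lambda>x. real (word_length G S g) \<le> 2 * real R + C) (ultrafilter y)"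
    proof eventually_elim
      case (elim x)
      note x = nbhd_carrier[OF elim(1)] and xg = nbhd_carrier[OF elim(3)]
      note fx = f_closed[OF near[of x]] and fxg = f_closed[OF near[of "x \<otimes> g"]]
      have "real (word_length G S g) = word_dist G S x (x \<otimes> g)"
        using word_dist_right_mult[OF x g] by simp
      also have "\<dots> \<le> word_dist G S x (f (near x)) + (word_dist G S (f (near x)) (f (near (x \<otimes> g)))
          + word_dist G S (f (near (x \<otimes> g))) (x \<otimes> g))"
        using word_dist_triangle[OF x fx xg] word_dist_triangle[OF fx fxg xg] by simp
      also have "\<dots> \<le> real R + (C + real R)"
        using near_nbhd[OF elim(1)] near_nbhd[OF elim(3)] word_dist_commute[OF xg fxg]
          C[OF near near, of x "x \<otimes> g"] elim(2) h by simp
      finally show ?case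
        by simp
    qed
    then have "real (word_length G S g) \<le> 2 * real R + C"
      using ultrafilter_neq_bot[OF y_beta] by auto
    then show ?thesis
      by (rule le_nat_floor)
  qed
  then show ?thesis
    by (intro finite_subset[OF _ finite_word_ball[of "nat \<lfloor>2 * real R + C\<rfloor>"]]) blast
qed

text \<open>The values are integers, so the image of every set is closed. A fibre is a finite union, over the
  group elements of the preceding lemma, of compact slices.\<close>
lemma locally_proper_displacement: "locally_proper G discr TY act displacement"
  unfolding locally_proper_def
proof (intro allI impI)
  fix K assume K: "compactin TY K"
  have KY: "K \<subseteq> Y"
    using compactin_subset_topspace[OF K] topspace_TY by simp
  define P where "P = {(y, g). y \<in> K \<and> g \<in> carrier G \<and> act y g \<in> K}"
  let ?T = "subtopology (prod_topology TY discr) P"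
  have top: "topspace ?T = P"
    using KY Y_subset by (auto simp: P_def)
  have "closed_map ?T euclideanreal displacement"
    unfolding closed_map_def
  proof (intro allI impI)
    fix A assume "closedin ?T A"
    then have "A \<subseteq> P"
      using closedin_subset top by metis
    have "displacement p \<in> \<int>" if "p \<in> A" for p
    proof -
      have "p \<in> P"
        using that \<open>A \<subseteq> P\<close> by blast
      then obtain y g where p: "p = (y, g)" "y \<in> Y" "g \<in> carrier G"
        using KY unfolding P_def by blast
      show ?thesis
        unfolding p(1) using displacement_in_Nats[OF p(2,3)] Nats_subset_Ints by (rule subsetD[rotated])
    qed
    then have "displacement ` A \<subseteq> \<int>"
      by blast
    then show "closedin euclideanreal (displacement ` A)"
      by (simp add: closed_subset_Ints)
  qed
  moreover have "compactin ?T {p \<in> topspace ?T. displacement p = r}" for r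
  proof -
    let ?F = "{g \<in> carrier G. \<exists>y\<in>K. act y g \<in> K \<and> displacement (y, g) = r}"
    let ?L = "\<lambda>g. {y \<in> Y. displacement (y, g) = r} \<inter> {y \<in> Y. act y g \<in> K} \<inter> K"
    have L: "compactin TY (?L g)" if g: "g \<in> carrier G" for g
    proof (intro closed_Int_compactin[OF _ K] closedin_Int)
      show "closedin TY {y \<in> Y. displacement (y, g) = r}"
        using closedin_continuous_map_preimage[OF continuous_displacement_slice[OF g], of "{r}"]
        unfolding topspace_TY by simp
      show "closedin TY {y \<in> Y. act y g \<in> K}"
        using closedin_continuous_map_preimage[OF continuous_act[OF g], of K]
          compactin_imp_closedin[OF Hausdorff_TY K] unfolding topspace_TY .
    qed
    have "{p \<in> P. displacement p = r} = (\<Union>g\<in>?F. ?L g \<times> {g})"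
      using KY by (auto simp: P_def)
    moreover have "compactin (prod_topology TY discr) (\<Union>g\<in>?F. ?L g \<times> {g})"
      using finitely_many_return_elements[OF K, of r] L
      by (intro compactin_Union) (auto simp: compactin_Times)
    ultimately have "compactin (prod_topology TY discr) {p \<in> P. displacement p = r}"
      by (simp only:)
    then show ?thesis
      unfolding top compactin_subtopology by blast
  qed
  ultimately show "proper_map (subtopology (prod_topology TY discr)
      {(y, g). y \<in> K \<and> g \<in> carrier G \<and> act y g \<in> K}) euclideanreal displacement"
    unfolding proper_map_def P_def by blast
qed

lemma a_T_menable: "a_T_menable_action G (discrete_topology (carrier G)) (subtopology (beta G) Y) act"
  unfolding a_T_menable_action_def beta_eq
  using continuous_right_action_TY continuous_displacement displacement_conditionally_negative_type
    locally_proper_displacement topspace_TY by auto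

end


theorem theorem7p9:
  fixes G :: "('g, 'm) monoid_scheme"
    and S :: "'g set"
    and V :: "nat \<Rightarrow> 'v set"
    and E :: "nat \<Rightarrow> ('v \<times> 'v) set"
    and d :: "nat \<times> 'v \<Rightarrow> nat \<times> 'v \<Rightarrow> real"
    and f :: "nat \<times> 'v \<Rightarrow> 'g"
    and Z :: "'g set"
  assumes "special_gromov_monster G S"
    and "box_space V E d"
    and "large_girth E"
    and "expander V E"
    and "coarse_embedding (box_points V) d (carrier G) (word_dist G S) f"
    and "Z = f ` box_points V"
  shows "a_T_menable_action G (discrete_topology (carrier G))
           (subtopology (beta G) (boundary_piece G S Z)) (beta_right_mult G)"
proof -
  have "group G" "finite_generating_set G S"
    using assms(1) by (auto simp: special_gromov_monster_def)
  then have "embedded_box_space G S V E d f Z"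
    using assms(2,3,5,6)
    by (intro embedded_box_space.intro word_metric.intro word_metric_axioms.intro
        embedded_box_space_axioms.intro)
  then show ?thesis
    by (rule embedded_box_space.a_T_menable)
qed

end
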